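(* Let $n$ be a positive integer, $n=2q+r$ with $r\in\{0,1\}$. Among all (weakly connected) digraphs on $n$ vertices without loops or multiple arcs that contain no directed $3$-cycle $\overrightarrow{C_3}$ as a subdigraph, the maximum Laplacian energy equals $$\frac{2q}{3}\left(3n^2-6qn+4q^2+2\right).$$ Moreover, the set of $\overrightarrow{C_3}$-free digraphs of order $n$ attaining this maximum is exactly the family $\overrightarrow{\mathcal{BK}^1_{n,p}}$ if $r=1$, and exactly the family $\overrightarrow{\mathcal{BK}^0_{n,p}}$ if $r=0$.
   Context: For a digraph $G$ on vertices $v_1,\dots,v_n$, $A(G)$ is the adjacency matrix, $D^+(G)$ the diagonal outdegree matrix, $L(G)=D^+(G)-A(G)$, and the Laplacian energy is $LE(G)=\sum_{i=1}^n\lambda_i^2$ with $\lambda_i$ the eigenvalues of $L(G)$; equivalently $LE(G)=\sum_i(d_i^+)^2+c_2$, with $c_2$ the number of directed closed walks of length $2$. A balanced complete bipartite digraph on a vertex set partitioned into $X,Y$ with $||X|-|Y||\leq 1$ has both arcs $(x,y)$ and $(y,x)$ for every $x\in X,y\in Y$ and no arcs inside $X$ or inside $Y$ (on one vertex it is the single vertex). For disjoint vertex sets, $V_i\mapsto V_j$ means every vertex of $V_i$ has an arc to every vertex of $V_j$ and there is no arc from $V_j$ to $V_i$. A digraph $\overrightarrow{BK_{n,p}}$ on $n$ vertices has a vertex partition $V_1,\dots,V_p$ such that each induced subdigraph on $V_i$ is a balanced complete bipartite digraph, $V_i\mapsto V_j$ for all $1\le i<j\le p$, and no other arcs. $\overrightarrow{\mathcal{BK}^0_{n,p}}$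 is the family of all such digraphs (any $p$) with $|V_i|\in\{2,4\}$ for all $i$; $\overrightarrow{\mathcal{BK}^1_{n,p}}$ is the family of all such digraphs (any $p$) with $|V_i|\in\{2,4\}$ for $1\le i\le p-1$ and $|V_p|\in\{1,3\}$. *)

theory Defs
  imports
    "Jordan_Normal_Form.Spectral_Radius"
    "Graph_Theory.Graph_Theory"
    "HOL-Library.Disjoint_Sets"
begin

text \<open>
  Digraphs are values of type \<^typ>\<open>'a pair_pre_digraph\<close> satisfying \<^const>\<open>pair_digraph\<close>:
  finite, no loops, and no multiple arcs because arcs are pairs of vertices.  The matrices
  refer to an enumeration \<open>v 0, \<dots>, v (n - 1)\<close> of the vertices.
\<close>

definition adjacency_mat :: "nat \<Rightarrow> (nat \<Rightarrow> 'a) \<Rightarrow> 'a pair_pre_digraph \<Rightarrow> complex mat" where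
  "adjacency_mat n v G = mat n n (\<lambda>(i, j). if (v i, v j) \<in> parcs G then 1 else 0)"

definition outdegree_mat :: "nat \<Rightarrow> (nat \<Rightarrow> 'a) \<Rightarrow> 'a pair_pre_digraph \<Rightarrow> complex mat" where
  "outdegree_mat n v G =
     mat n n (\<lambda>(i, j). if i = j then of_nat (out_degree (with_proj G) (v i)) else 0)"

definition laplacian_mat :: "nat \<Rightarrow> (nat \<Rightarrow> 'a) \<Rightarrow> 'a pair_pre_digraph \<Rightarrow> complex mat" where
  "laplacian_mat n v G = outdegree_mat n v G - adjacency_mat n v G"

text \<open>
  The eigenvalues \<open>\<lambda>\<^sub>1, \<dots>, \<lambda>\<^sub>n\<close> are complex in general and are counted with algebraic
  multiplicity, so the sum of their squares is formed in the complex numbers.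
\<close>

definition laplacian_energy :: "nat \<Rightarrow> (nat \<Rightarrow> 'a) \<Rightarrow> 'a pair_pre_digraph \<Rightarrow> complex" where
  "laplacian_energy n v G =
     (\<Sum>l\<in>spectrum (laplacian_mat n v G).
        of_nat (Polynomial.order l (char_poly (laplacian_mat n v G))) * l ^ 2)"

text \<open>\<^const>\<open>pre_digraph.cycle\<close> is the notion of a directed cycle (as a list of arcs).\<close>

definition C3_free :: "'a pair_pre_digraph \<Rightarrow> bool" where
  "C3_free G \<longleftrightarrow> \<not> (\<exists>c. pre_digraph.cycle (with_proj G) c \<and> length c = 3)"

definition C3_free_digraphs :: "'a set \<Rightarrow> 'a pair_pre_digraph set" where
  "C3_free_digraphs W = {G. pair_digraph G \<and> pverts G = W \<and> C3_free G}"

definition weakly_connected :: "'a pair_pre_digraph \<Rightarrow> bool" where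
  "weakly_connected G \<longleftrightarrow> Digraph_Component.connected (with_proj G)"

text \<open>
  Graphs in the sense of \<^const>\<open>complete_bipartite_digraph\<close> are symmetric digraphs, so both
  arcs are present between the two sides.  A side may be empty: the case
  \<open>{a, b} = {0, 1}\<close> is the single vertex.
\<close>

definition balanced_complete_bipartite :: "('a, 'b) pre_digraph \<Rightarrow> bool" where
  "balanced_complete_bipartite H \<longleftrightarrow>
     (\<exists>a b. \<bar>int a - int b\<bar> \<le> 1 \<and> complete_bipartite_digraph a b H)"

definition maps_onto :: "'a pair_pre_digraph \<Rightarrow> 'a set \<Rightarrow> 'a set \<Rightarrow> bool" where
  "maps_onto G S T \<longleftrightarrow> (\<forall>x\<in>S. \<forall>y\<in>T. (x, y) \<in> parcs G \<and> (y, x) \<notin> parcs G)"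

text \<open>
  ``No other arcs'' needs no separate clause: every pair of vertices lies either in one
  class or in two different classes, and its arcs are then prescribed.
\<close>

definition BK_partition :: "nat \<Rightarrow> (nat \<Rightarrow> 'a set) \<Rightarrow> 'a pair_pre_digraph \<Rightarrow> bool" where
  "BK_partition p V G \<longleftrightarrow>
     1 \<le> p \<and>
     (\<Union>i\<in>{1..p}. V i) = pverts G \<and>
     (\<forall>i\<in>{1..p}. V i \<noteq> {}) \<and>
     disjoint_family_on V {1..p} \<and>
     (\<forall>i\<in>{1..p}. balanced_complete_bipartite (with_proj G \<restriction> V i)) \<and>
     (\<forall>i j. 1 \<le> i \<and> i < j \<and> j \<le> p \<longrightarrow> maps_onto G (V i) (V j))"

definition BK0 :: "'a set \<Rightarrow> 'a pair_pre_digraph set" where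
  "BK0 W = {G. pair_digraph G \<and> pverts G = W \<and>
     (\<exists>p V. BK_partition p V G \<and> (\<forall>i\<in>{1..p}. card (V i) \<in> {2, 4}))}"

definition BK1 :: "'a set \<Rightarrow> 'a pair_pre_digraph set" where
  "BK1 W = {G. pair_digraph G \<and> pverts G = W \<and>
     (\<exists>p V. BK_partition p V G \<and> (\<forall>i\<in>{1..<p}. card (V i) \<in> {2, 4}) \<and> card (V p) \<in> {1, 3})}"

end

theory Submission
  imports Defs
begin

text \<open>
  By Schur triangularisation the Laplacian energy is the trace of \<open>L\<^sup>2\<close>, that is, the sum of the
  squared outdegrees plus the number of ordered digons.  Take any digon \<open>{x, y}\<close> of a \<open>C\<^sub>3\<close>-free
  digraph on \<open>m + 2\<close> vertices and delete \<open>x\<close> and then \<open>y\<close>.  If a deleted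
  vertex has \<open>t\<close> in-neighbours besides its digon neighbours, then these span at most \<open>t\<^sup>2 / 2\<close> arcs, and
  no digon neighbour sends an arc to an in-neighbour.  Hence the energy drops by at most
  \<open>2 (m + 1)\<^sup>2 + 2\<close>, which is the increment of \<open>(n\<^sup>3 + 2 n) / 3 - (n mod 2)\<close> from \<open>m\<close> to \<open>m + 2\<close>;
  without digons the bound is far from tight.

  If the drop is maximal, the vertices split into \<open>P\<close>, \<open>B\<close>, \<open>Q\<close>, where \<open>B\<close> consists of \<open>x\<close>, \<open>y\<close> and at
  most one digon neighbour of each, \<open>P\<close> is even and dominates \<open>B \<union> Q\<close>, and \<open>B\<close> dominates \<open>Q\<close>.
  The energy of such an ordered sum forces \<open>P\<close> and \<open>Q\<close> to be extremal too, and \<open>Q = {}\<close> when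
  \<open>card B = 3\<close>, so that the structure follows by induction.
\<close>

section \<open>Sums of squared eigenvalues\<close>

definition mat_trace :: "'a :: comm_ring_1 mat \<Rightarrow> 'a" where
  "mat_trace A = (\<Sum>i<dim_row A. A $$ (i, i))"

lemma mat_trace_mult:
  assumes "A \<in> carrier_mat n m" "B \<in> carrier_mat m n"
  shows "mat_trace (A * B) = (\<Sum>i<n. \<Sum>j<m. A $$ (i, j) * B $$ (j, i))"
  using assms by (auto simp: mat_trace_def scalar_prod_def atLeast0LessThan intro!: sum.cong)

lemma mat_trace_mult_commute:
  assumes "A \<in> carrier_mat n m" "B \<in> carrier_mat m n"
  shows "mat_trace (A * B) = mat_trace (B * A)"
  unfolding mat_trace_mult[OF assms] mat_trace_mult[OF assms(2,1)]
  by (subst sum.swap) (simp add: mult.commute)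

lemma mat_trace_similar:
  assumes A: "A \<in> carrier_mat n n" and sim: "similar_mat_wit A B P Q"
  shows "mat_trace A = mat_trace B"
proof -
  note D = similar_mat_witD2[OF A sim]
  have "mat_trace A = mat_trace (P * (B * Q))" using D by (simp add: assoc_mult_mat)
  also have "\<dots> = mat_trace ((B * Q) * P)" using D by (intro mat_trace_mult_commute) auto
  also have "(B * Q) * P = B * (Q * P)" using D by (intro assoc_mult_mat) auto
  also have "\<dots> = B" using D by simp
  finally show ?thesis .
qed

text \<open>Of two transposed off-diagonal entries one lies below the diagonal, so only the products
  with \<open>i = j\<close> survive.\<close>

lemma upper_triangular_trace_square:
  assumes B: "B \<in> carrier_mat n n" and ut: "upper_triangular B"
  shows "mat_trace (B * B) = (\<Sum>x\<leftarrow>diag_mat B. x ^ 2)"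
proof -
  have "B $$ (i, j) * B $$ (j, i) = (if i = j then B $$ (i, i) ^ 2 else 0)" if "i < n" "j < n" for i j
    using that B ut by (cases i j rule: linorder_cases) (auto simp: upper_triangular_def power2_eq_square)
  then have "mat_trace (B * B) = (\<Sum>i<n. B $$ (i, i) ^ 2)"
    unfolding mat_trace_mult[OF B B] by simp
  also have "\<dots> = (\<Sum>x\<leftarrow>diag_mat B. x ^ 2)"
    using B by (simp add: diag_mat_def sum_list_sum_nth atLeast0LessThan comp_def)
  finally show ?thesis .
qed

lemma proots_linear_factors:
  "proots (\<Prod>a\<leftarrow>es. [:- a, 1 :: 'a :: field:]) = mset es"
proof (induction es)
  case (Cons e es)
  have "(\<Prod>a\<leftarrow>es. [:- a, 1 :: 'a:]) \<noteq> 0" by (auto simp: prod_list_zero_iff)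
  then have "proots ([:- e, 1:] * (\<Prod>a\<leftarrow>es. [:- a, 1:])) = {#e#} + mset es"
    using Cons by (subst proots_mult) (auto simp del: mult_pCons_left)
  then show ?case by (simp del: mult_pCons_left)
qed simp

lemma sum_count_list:
  fixes g :: "'a \<Rightarrow> 'b :: comm_semiring_1"
  assumes "finite S" "set xs \<subseteq> S"
  shows "(\<Sum>l\<in>S. of_nat (count (mset xs) l) * g l) = (\<Sum>x\<leftarrow>xs. g x)"
  using assms(2)
proof (induction xs)
  case (Cons a xs)
  have "(\<Sum>l\<in>S. of_nat (count (mset (a # xs)) l) * g l)
      = (\<Sum>l\<in>S. of_nat (count (mset xs) l) * g l + (if l = a then g a else 0))"
    by (intro sum.cong refl) (auto simp: algebra_simps)
  then show ?case using Cons assms(1) by (simp add: sum.distrib add.commute)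
qed simp

text \<open>Schur triangularisation puts the eigenvalues with multiplicity on the diagonal of
  \<open>B\<close>, and the same \<open>P\<close>, \<open>Q\<close> conjugate the squares, whose
  traces therefore agree.\<close>

lemma sum_squares_eigenvalues:
  fixes A :: "complex mat"
  assumes A: "A \<in> carrier_mat n n"
  shows "(\<Sum>l\<in>spectrum A. of_nat (Polynomial.order l (char_poly A)) * l ^ 2) = mat_trace (A * A)"
proof -
  obtain es where es: "char_poly A = (\<Prod>a\<leftarrow>es. [:- a, 1:])"
    using char_poly_factorized[OF A] by blast
  obtain B P Q where "schur_decomposition A es = (B, P, Q)"
    by (cases "schur_decomposition A es")
  from schur_decomposition[OF A es this]
  have sim: "similar_mat_wit A B P Q" and ut: "upper_triangular B" and diag: "diag_mat B = es"
    by auto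
  have B: "B \<in> carrier_mat n n" using similar_mat_witD2[OF A sim] by auto
  have "similar_mat_wit (A ^\<^sub>m 2) (B ^\<^sub>m 2) P Q" using sim by (rule similar_mat_wit_pow)
  then have "mat_trace (A ^\<^sub>m 2) = mat_trace (B ^\<^sub>m 2)"
    using A by (intro mat_trace_similar[of _ n]) auto
  then have "mat_trace (A * A) = mat_trace (B * B)"
    using A B by (simp add: numeral_2_eq_2)
  also have "\<dots> = (\<Sum>x\<leftarrow>es. x ^ 2)"
    using upper_triangular_trace_square[OF B ut] diag by simp
  \<comment> \<open>The list is regrouped by distinct values; \<open>count (mset es) l\<close> is
    the order of the root \<open>l\<close> because \<open>mset es\<close> is the multiset of
    roots.\<close>
  also have "\<dots> = (\<Sum>l\<in>set es. of_nat (count (mset es) l) * l ^ 2)"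
    by (rule sum_count_list[symmetric]) auto
  also have "set es = spectrum A"
    unfolding spectrum_def eigenvalue_root_char_poly[OF A] es
    by (auto simp: poly_prod_list prod_list_zero_iff)
  also have "count (mset es) = (\<lambda>l. Polynomial.order l (char_poly A))"
    unfolding es proots_linear_factors[symmetric]
    by (intro ext count_proots) (auto simp: prod_list_zero_iff)
  finally show ?thesis by simp
qed

section \<open>Energy of an arc relation\<close>

text \<open>
  The two vertices of a digon have \<open>a\<close>, \<open>b\<close> pure in-neighbours, \<open>g\<close>, \<open>d\<close> pure out-neighbours and \<open>c\<close>, \<open>h\<close>
  digon neighbours among the other \<open>m\<close> vertices; \<open>p\<close> and \<open>q\<close> count the unions of the pure in- and
  out-neighbourhoods.  Keeping the gaps on the left-hand side gives the equality case.
\<close>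

lemma digon_increment_bound:
  fixes a b g d p q c h m :: int
  assumes nonneg: "0 \<le> a" "0 \<le> b" "0 \<le> g" "0 \<le> d" "0 \<le> c" "0 \<le> h"
    and le: "a \<le> p" "b \<le> p" "g \<le> q" "d \<le> q" "p + q + c + h \<le> m"
  shows "(g + c + 1)\<^sup>2 + 2 * (c + 1) + (a + (c + 1)) + a\<^sup>2 + 2 * a * (c + 1)
      + 2 * (a + (c + 1)) * (m - a - c)
      + ((d + h)\<^sup>2 + 2 * h + (b + h) + b\<^sup>2 + 2 * b * h + 2 * (b + h) * (m - b - h))
      + (p - a) + (p - b) + (q - g) + (q - d) + (m - (p + q + c + h)) + c * (c - 1) + h * (h - 1)
    \<le> 2 * (m + 1)\<^sup>2 + 2"
proof -
  \<comment> \<open>Written in the five gaps, the difference of the two sides no longer contains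
    \<open>p\<close>, and it splits into terms of visible sign.\<close>
  define a' b' g' d' k where "a' = p - a" and "b' = p - b" and "g' = q - g" and "d' = q - d"
    and "k = m - (p + q + c + h)"
  have nn: "0 \<le> a'" "0 \<le> b'" "0 \<le> g'" "0 \<le> d'" "0 \<le> k" "g' \<le> q" "d' \<le> q" "0 \<le> p" "0 \<le> q"
    using nonneg le by (auto simp: a'_def b'_def g'_def d'_def k_def)
  have eq: "a = p - a'" "b = p - b'" "g = q - g'" "d = q - d'" "m = p + q + c + h + k"
    by (auto simp: a'_def b'_def g'_def d'_def k_def)
  \<comment> \<open>Integrality enters here; the term in question is
    \<open>d' * (d' - 1)\<close>.\<close>
  have sq: "0 \<le> z * (z - 1)" if "0 \<le> z" for z :: int
    using that by (cases "z = 0") auto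
  have "2 * (m + 1)\<^sup>2 + 2
    - ((g + c + 1)\<^sup>2 + 2 * (c + 1) + (a + (c + 1)) + a\<^sup>2 + 2 * a * (c + 1)
      + 2 * (a + (c + 1)) * (m - a - c)
      + ((d + h)\<^sup>2 + 2 * h + (b + h) + b\<^sup>2 + 2 * b * h + 2 * (b + h) * (m - b - h))
      + a' + b' + g' + d' + k + c * (c - 1) + h * (h - 1))
    = g' * (2 * (q - g') + 2 * c + 1) + g' * g' + d' * (2 * (q - d') + 2 * h) + d' * (d' - 1)
      + (a' * (2 * (q + h + k)) + a' * a') + (b' * (2 * (q + c + k)) + b' * b')
      + (k * (1 + 4 * q + 2 * c + 2 * h) + 2 * k * k)"
    unfolding eq by (simp add: power2_eq_square algebra_simps)
  also have "0 \<le> \<dots>"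
  proof -
    have "0 \<le> g' * (2 * (q - g') + 2 * c + 1)" "0 \<le> g' * g'" "0 \<le> d' * (2 * (q - d') + 2 * h)"
      "0 \<le> a' * (2 * (q + h + k)) + a' * a'" "0 \<le> b' * (2 * (q + c + k)) + b' * b'"
      "0 \<le> k * (1 + 4 * q + 2 * c + 2 * h) + 2 * k * k"
      using nn nonneg by simp_all
    with sq[OF nn(4)] show ?thesis by linarith
  qed
  finally show ?thesis unfolding a'_def b'_def g'_def d'_def k_def by linarith
qed

text \<open>Three times the maximal energy, which avoids division on the integers.\<close>

definition energy_bound :: "int \<Rightarrow> int" where
  "energy_bound n = n ^ 3 + 2 * n - 3 * (n mod 2)"

locale digraph_rel =
  fixes E :: "('a \<times> 'a) set"
begin

definition arc :: "'a \<Rightarrow> 'a \<Rightarrow> int" where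
  "arc x y = of_bool ((x, y) \<in> E)"

definition arcs_from_to :: "'a set \<Rightarrow> 'a set \<Rightarrow> int" where
  "arcs_from_to A B = (\<Sum>x\<in>A. \<Sum>y\<in>B. arc x y)"

text \<open>The trace of the squared Laplacian of the subdigraph induced on \<open>V\<close>. Only
  arcs inside \<open>V\<close> count, so deleting vertices shrinks \<open>V\<close> and leaves
  \<open>E\<close> fixed.\<close>

definition energy :: "'a set \<Rightarrow> int" where
  "energy V = (\<Sum>x\<in>V. (\<Sum>y\<in>V. arc x y)\<^sup>2) + (\<Sum>x\<in>V. \<Sum>y\<in>V. arc x y * arc y x)"

definition dominates :: "'a set \<Rightarrow> 'a set \<Rightarrow> bool" where
  "dominates A B \<longleftrightarrow> A \<times> B \<subseteq> E \<and> B \<times> A \<inter> E = {}"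

text \<open>A side may be empty, so that a single vertex is a block.\<close>

definition block :: "'a set \<Rightarrow> bool" where
  "block B \<longleftrightarrow> (\<exists>X Y. finite B \<and> B = X \<union> Y \<and> X \<inter> Y = {} \<and>
     \<bar>int (card X) - int (card Y)\<bar> \<le> 1 \<and> E \<inter> B \<times> B = X \<times> Y \<union> Y \<times> X)"

text \<open>Both extremal families in one inductive form: \<open>step\<close> prepends an even
  block, and an odd block can only close the chain. The even family closes with
  \<open>empty\<close>.\<close>

inductive block_chain :: "'a set \<Rightarrow> bool" where
  empty: "block_chain {}"
| last: "block B \<Longrightarrow> card B \<in> {1, 3} \<Longrightarrow> block_chain B"
| step: "block B \<Longrightarrow> card B \<in> {2, 4} \<Longrightarrow> B \<inter> V = {} \<Longrightarrow> dominates B V \<Longrightarrow> block_chain V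
    \<Longrightarrow> block_chain (B \<union> V)"

lemma arc_nonneg [simp]: "0 \<le> arc x y" and arc_le_1 [simp]: "arc x y \<le> 1"
  by (auto simp: arc_def)

lemma arc_eq [simp]: "(x, y) \<in> E \<Longrightarrow> arc x y = 1" "(x, y) \<notin> E \<Longrightarrow> arc x y = 0"
  by (auto simp: arc_def)

lemma arcs_from_to_Un_left:
  "finite A \<Longrightarrow> finite B \<Longrightarrow> A \<inter> B = {} \<Longrightarrow>
   arcs_from_to (A \<union> B) C = arcs_from_to A C + arcs_from_to B C"
  unfolding arcs_from_to_def by (rule sum.union_disjoint)

lemma arcs_from_to_Un_right:
  "finite A \<Longrightarrow> finite B \<Longrightarrow> A \<inter> B = {} \<Longrightarrow>
   arcs_from_to C (A \<union> B) = arcs_from_to C A + arcs_from_to C B"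
  unfolding arcs_from_to_def by (simp add: sum.union_disjoint sum.distrib)

lemma arcs_from_to_le: "arcs_from_to A B \<le> int (card A) * int (card B)"
proof -
  have "arcs_from_to A B \<le> (\<Sum>x\<in>A. \<Sum>y\<in>B. 1)"
    unfolding arcs_from_to_def by (intro sum_mono) simp
  then show ?thesis by simp
qed

lemma arcs_from_to_zero: "A \<times> B \<inter> E = {} \<Longrightarrow> arcs_from_to A B = 0"
  unfolding arcs_from_to_def by (intro sum.neutral ballI arc_eq) auto

lemma full_if_arcs_from_to_eq:
  assumes "finite A" "finite B" "arcs_from_to A B = int (card A) * int (card B)"
  shows "A \<times> B \<subseteq> E"
proof clarify
  fix x y assume xy: "x \<in> A" "y \<in> B"
  show "(x, y) \<in> E"
  proof (rule ccontr)
    assume "(x, y) \<notin> E"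
    have "(\<Sum>z\<in>A \<times> B. arc (fst z) (snd z)) < (\<Sum>z\<in>A \<times> B. 1)"
    proof (rule sum_strict_mono_ex1)
      show "\<exists>z\<in>A \<times> B. arc (fst z) (snd z) < 1"
        using xy \<open>(x, y) \<notin> E\<close> by (intro bexI[of _ "(x, y)"]) auto
    qed (use assms in auto)
    then have "arcs_from_to A B < int (card A) * int (card B)"
      by (simp add: arcs_from_to_def sum.cartesian_product card_cartesian_product case_prod_beta)
    with assms(3) show False by simp
  qed
qed

text \<open>Each vertex of \<open>A\<close> gains \<open>card B\<close> in outdegree, and expanding
  the square gives the two cross terms. No digon joins \<open>A\<close> to \<open>B\<close>, and
  outdegrees in \<open>B\<close> stay the same.\<close>

lemma energy_ordered_sum:
  assumes fin: "finite A" "finite B" and disj: "A \<inter> B = {}" and dom: "dominates A B"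
  shows "energy (A \<union> B) =
    energy A + 2 * int (card B) * arcs_from_to A A + int (card A) * int (card B) ^ 2 + energy B"
proof -
  have full: "\<And>x y. x \<in> A \<Longrightarrow> y \<in> B \<Longrightarrow> arc x y = 1"
    and none: "\<And>x y. x \<in> A \<Longrightarrow> y \<in> B \<Longrightarrow> arc y x = 0"
    using dom by (auto simp: dominates_def arc_def)
  have "(\<Sum>x\<in>A \<union> B. (\<Sum>y\<in>A \<union> B. arc x y)\<^sup>2)
      = (\<Sum>x\<in>A. ((\<Sum>y\<in>A. arc x y) + int (card B))\<^sup>2) + (\<Sum>x\<in>B. (\<Sum>y\<in>B. arc x y)\<^sup>2)"
    using fin disj full none by (simp add: sum.union_disjoint)
  also have "(\<Sum>x\<in>A. ((\<Sum>y\<in>A. arc x y) + int (card B))\<^sup>2)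
      = (\<Sum>x\<in>A. (\<Sum>y\<in>A. arc x y)\<^sup>2) + 2 * int (card B) * arcs_from_to A A
        + int (card A) * int (card B) ^ 2"
    by (simp add: arcs_from_to_def power2_sum sum.distrib sum_distrib_left sum_distrib_right
        mult.commute mult.left_commute)
  finally have 1: "(\<Sum>x\<in>A \<union> B. (\<Sum>y\<in>A \<union> B. arc x y)\<^sup>2)
      = (\<Sum>x\<in>A. (\<Sum>y\<in>A. arc x y)\<^sup>2) + 2 * int (card B) * arcs_from_to A A
        + int (card A) * int (card B) ^ 2 + (\<Sum>x\<in>B. (\<Sum>y\<in>B. arc x y)\<^sup>2)" .
  have 2: "(\<Sum>x\<in>A \<union> B. \<Sum>y\<in>A \<union> B. arc x y * arc y x)
      = (\<Sum>x\<in>A. \<Sum>y\<in>A. arc x y * arc y x) + (\<Sum>x\<in>B. \<Sum>y\<in>B. arc x y * arc y x)"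
    using fin disj full none by (simp add: sum.union_disjoint)
  show ?thesis unfolding energy_def 1 2 by simp
qed

text \<open>Balance and \<open>card B \<le> 4\<close> leave sides of at most two vertices, hence
  finitely many cases. At five vertices equality fails: sides of sizes 2 and 3 give energy 42, while
  a third of \<open>energy_bound 5\<close> is 44.\<close>

lemma block_energy:
  assumes "block B" "card B \<in> {1, 2, 3, 4}"
  shows "3 * energy B = energy_bound (int (card B))"
    and "2 * arcs_from_to B B = int (card B) ^ 2 - int (card B) mod 2"
proof -
  obtain X Y where fin: "finite X" "finite Y" and B: "B = X \<union> Y" and XY: "X \<inter> Y = {}"
    and bal: "\<bar>int (card X) - int (card Y)\<bar> \<le> 1" and E: "E \<inter> B \<times> B = X \<times> Y \<union> Y \<times> X"
    using assms(1) unfolding block_def by auto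
  have arcs: "\<And>x y. x \<in> X \<Longrightarrow> y \<in> Y \<Longrightarrow> arc x y = 1" "\<And>x y. x \<in> X \<Longrightarrow> y \<in> Y \<Longrightarrow> arc y x = 1"
    "\<And>x y. x \<in> X \<Longrightarrow> y \<in> X \<Longrightarrow> arc x y = 0" "\<And>x y. x \<in> Y \<Longrightarrow> y \<in> Y \<Longrightarrow> arc x y = 0"
    using E B XY unfolding arc_def by auto
  have en: "energy B = int (card X) * int (card Y)^2 + int (card Y) * int (card X)^2
      + 2 * int (card X) * int (card Y)"
    unfolding energy_def B using fin XY arcs by (simp add: sum.union_disjoint)
  have ar: "arcs_from_to B B = 2 * int (card X) * int (card Y)"
    unfolding arcs_from_to_def B using fin XY arcs by (simp add: sum.union_disjoint)
  have cB: "card B = card X + card Y"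
    unfolding B using fin XY by (rule card_Un_disjoint)
  have "card X \<le> 2" "card Y \<le> 2"
    using bal assms(2) unfolding cB by auto
  then have "card X = 0 \<or> card X = 1 \<or> card X = 2" "card Y = 0 \<or> card Y = 1 \<or> card Y = 2"
    by linarith+
  then show "3 * energy B = energy_bound (int (card B))"
    "2 * arcs_from_to B B = int (card B) ^ 2 - int (card B) mod 2"
    using bal assms(2) unfolding en ar cB energy_bound_def by (elim disjE; simp)+
qed

lemma block_chain_finite: "block_chain V \<Longrightarrow> finite V"
  by (induction rule: block_chain.induct) (auto simp: block_def)

lemma block_chain_energy:
  "block_chain V \<Longrightarrow> 3 * energy V = energy_bound (int (card V))"
proof (induction rule: block_chain.induct)
  case empty
  show ?case by (simp add: energy_def energy_bound_def)
next
  case (last B)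
  then show ?case by (intro block_energy(1)) auto
next
  case (step B V)
  have fin: "finite B" "finite V"
    using step.hyps block_chain_finite by (auto simp: block_def)
  have cU: "card (B \<union> V) = card B + card V"
    using fin step.hyps(3) by (rule card_Un_disjoint)
  have b: "card B \<in> {1, 2, 3, 4}" using step.hyps(2) by auto
  have m: "int (card (B \<union> V)) mod 2 = int (card V) mod 2" "int (card B) mod 2 = 0"
    unfolding cU using step.hyps(2) by (elim insertE; simp; presburger)+
  \<comment> \<open>An even block has exactly \<open>card B ^ 2 / 2\<close> arcs, so the cross terms
    are those of the cube of \<open>card B + card V\<close>.\<close>
  have "2 * int (card V) * arcs_from_to B B = int (card V) * int (card B) ^ 2"
    using block_energy(2)[OF step.hyps(1) b] m(2) by (simp add: mult.assoc mult.left_commute)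
  then have "3 * energy (B \<union> V) = int (card B) ^ 3 + 2 * int (card B)
      + 3 * (int (card V) * int (card B) ^ 2) + 3 * (int (card B) * int (card V) ^ 2) + 3 * energy V"
    using energy_ordered_sum[OF fin step.hyps(3,4)] block_energy(1)[OF step.hyps(1) b] m(2)
    unfolding energy_bound_def by linarith
  then show ?case
    unfolding energy_bound_def m(1) step.IH unfolding cU of_nat_add
    by (simp add: power3_eq_cube power2_eq_square algebra_simps)
qed

text \<open>Only the last block may be odd, so an even chain \<open>P\<close> ends in
  \<open>empty\<close>, where \<open>R\<close> can be attached; the case \<open>last\<close>
  contradicts parity.\<close>

lemma block_chain_append:
  assumes "block_chain P" "even (card P)" "block_chain R" "P \<inter> R = {}" "dominates P R"
  shows "block_chain (P \<union> R)"
  using assms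
proof (induction rule: block_chain.induct)
  case empty
  then show ?case by simp
next
  case (last B)
  then show ?case by auto
next
  case (step B V)
  have fin: "finite B" "finite V"
    using step.hyps block_chain_finite by (auto simp: block_def)
  have "card (B \<union> V) = card B + card V"
    using fin step.hyps(3) by (rule card_Un_disjoint)
  then have "even (card V)" using step.hyps(2) step.prems(1) by auto
  moreover have "V \<inter> R = {}" "dominates V R"
    using step.prems by (auto simp: dominates_def)
  ultimately have "block_chain (V \<union> R)"
    using step.IH step.prems(2) by blast
  moreover have "B \<inter> (V \<union> R) = {}" "dominates B (V \<union> R)"
    using step.hyps(3,4) step.prems(3,4) by (auto simp: dominates_def)
  ultimately have "block_chain (B \<union> (V \<union> R))"
    using block_chain.step step.hyps(1,2) by blast
  then show ?case by (simp add: Un_assoc)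
qed

section \<open>Neighbourhoods of a vertex, split into pure in-, pure out- and digon
  neighbours\<close>

definition in_only :: "'a set \<Rightarrow> 'a \<Rightarrow> 'a set" where
  "in_only V x = {z \<in> V. (z, x) \<in> E \<and> (x, z) \<notin> E}"

definition out_only :: "'a set \<Rightarrow> 'a \<Rightarrow> 'a set" where
  "out_only V x = {z \<in> V. (x, z) \<in> E \<and> (z, x) \<notin> E}"

definition digon_nbrs :: "'a set \<Rightarrow> 'a \<Rightarrow> 'a set" where
  "digon_nbrs V x = {z \<in> V. (x, z) \<in> E \<and> (z, x) \<in> E}"

lemma sum_over_in_nbrs:
  assumes "finite U"
  shows "(\<Sum>z\<in>U. arc z x * g z) = (\<Sum>z\<in>in_only U x \<union> digon_nbrs U x. g z)"
proof -
  have "in_only U x \<union> digon_nbrs U x = {z \<in> U. (z, x) \<in> E}"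
    by (auto simp: in_only_def digon_nbrs_def)
  then show ?thesis
    using assms by (simp add: sum.inter_filter arc_def of_bool_def if_distrib[of "\<lambda>c. c * _"] cong: if_cong)
qed

lemma card_in_nbrs:
  assumes "finite U"
  shows "card (in_only U x \<union> digon_nbrs U x) = card (in_only U x) + card (digon_nbrs U x)"
  using assms by (intro card_Un_disjoint) (auto simp: in_only_def digon_nbrs_def)

lemma out_degree_split:
  assumes "finite U"
  shows "(\<Sum>y\<in>U. arc x y) = int (card (out_only U x)) + int (card (digon_nbrs U x))"
proof -
  have "out_only U x \<union> digon_nbrs U x = {y \<in> U. (x, y) \<in> E}"
    by (auto simp: out_only_def digon_nbrs_def)
  moreover have "card (out_only U x \<union> digon_nbrs U x) = card (out_only U x) + card (digon_nbrs U x)"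
    using assms by (intro card_Un_disjoint) (auto simp: out_only_def digon_nbrs_def)
  ultimately show ?thesis
    using assms by (simp add: arc_def of_bool_def sum.If_cases Int_def flip: of_nat_add)
qed

lemma digon_sum:
  assumes "finite U"
  shows "(\<Sum>y\<in>U. arc x y * arc y x) = int (card (digon_nbrs U x))"
proof -
  have "(\<Sum>y\<in>U. arc x y * arc y x) = (\<Sum>y\<in>U. if y \<in> digon_nbrs U x then 1 else 0)"
    by (intro sum.cong) (auto simp: digon_nbrs_def arc_def)
  also have "\<dots> = int (card (digon_nbrs U x))"
    using assms by (simp add: sum.If_cases Int_def digon_nbrs_def conj_ac)
  finally show ?thesis .
qed

end

section \<open>Upper bound and extremal structure\<close>

text \<open>With irreflexivity, the three vertices in \<open>no_C3\<close> are automatically distinct.\<close>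

locale c3_free_rel = digraph_rel +
  assumes irrefl: "(x, x) \<notin> E"
    and no_C3: "(x, y) \<in> E \<Longrightarrow> (y, z) \<in> E \<Longrightarrow> (z, x) \<notin> E"
begin

text \<open>Only the in-neighbours \<open>T \<union> S\<close> of \<open>x\<close> change their
  outdegree, each by one, which adds twice the old outdegree plus one to its square. The old
  outdegrees are then split by heads in \<open>T\<close>, in \<open>S\<close> and in the rest of
  \<open>U\<close>.\<close>

lemma energy_insert:
  assumes fin: "finite U" and x: "x \<notin> U"
  defines "T \<equiv> in_only U x" and "S \<equiv> digon_nbrs U x" and "d \<equiv> \<Sum>y\<in>U. arc x y"
  shows "energy (insert x U) = energy U + d ^ 2 + 2 * int (card S)
    + (int (card T) + int (card S)) + 2 * arcs_from_to T T + 2 * arcs_from_to T S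
    + 2 * arcs_from_to (T \<union> S) (U - T - S)"
proof -
  have finTS: "finite T" "finite S" "T \<inter> S = {}" and TSU: "T \<union> S \<subseteq> U"
    using fin by (auto simp: T_def S_def in_only_def digon_nbrs_def)
  have "(\<Sum>z\<in>U. (\<Sum>y\<in>insert x U. arc z y)\<^sup>2)
      = (\<Sum>z\<in>U. (\<Sum>y\<in>U. arc z y)\<^sup>2 + arc z x * (2 * (\<Sum>y\<in>U. arc z y) + 1))"
  proof (intro sum.cong refl)
    fix z assume "z \<in> U"
    have "arc z x * arc z x = arc z x" by (simp add: arc_def)
    then show "(\<Sum>y\<in>insert x U. arc z y)\<^sup>2
        = (\<Sum>y\<in>U. arc z y)\<^sup>2 + arc z x * (2 * (\<Sum>y\<in>U. arc z y) + 1)"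
      using fin x by (simp add: power2_sum algebra_simps power2_eq_square)
  qed
  also have "\<dots> = (\<Sum>z\<in>U. (\<Sum>y\<in>U. arc z y)\<^sup>2)
      + (\<Sum>z\<in>T \<union> S. 2 * (\<Sum>y\<in>U. arc z y) + 1)"
    unfolding T_def S_def by (simp only: sum.distrib sum_over_in_nbrs[OF fin])
  also have "(\<Sum>z\<in>T \<union> S. 2 * (\<Sum>y\<in>U. arc z y) + 1)
      = 2 * arcs_from_to (T \<union> S) U + (int (card T) + int (card S))"
    using card_in_nbrs[OF fin, of x]
    by (simp add: arcs_from_to_def sum.distrib sum_distrib_left T_def S_def flip: of_nat_add)
  finally have 1: "(\<Sum>z\<in>insert x U. (\<Sum>y\<in>insert x U. arc z y)\<^sup>2) = d ^ 2
      + (\<Sum>z\<in>U. (\<Sum>y\<in>U. arc z y)\<^sup>2) + 2 * arcs_from_to (T \<union> S) U + (int (card T) + int (card S))"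
    using fin x irrefl by (simp add: d_def)
  have "(\<Sum>z\<in>U. arc z x * arc x z) = int (card S)"
    using digon_sum[OF fin, of x] by (simp add: S_def mult.commute)
  then have 2: "(\<Sum>z\<in>insert x U. \<Sum>y\<in>insert x U. arc z y * arc y z)
      = 2 * int (card S) + (\<Sum>z\<in>U. \<Sum>y\<in>U. arc z y * arc y z)"
    using fin x irrefl digon_sum[OF fin, of x] by (simp add: S_def sum.distrib)
  have U: "U = (T \<union> S) \<union> (U - T - S)" using TSU by blast
  have "arcs_from_to (T \<union> S) U = arcs_from_to (T \<union> S) (T \<union> S) + arcs_from_to (T \<union> S) (U - T - S)"
    by (subst U, subst arcs_from_to_Un_right) (use fin finTS in auto)
  moreover have "arcs_from_to (T \<union> S) (T \<union> S)
      = arcs_from_to T T + arcs_from_to T S + arcs_from_to S (T \<union> S)"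
    using finTS by (simp add: arcs_from_to_Un_right arcs_from_to_Un_left)
  \<comment> \<open>An arc from a digon neighbour \<open>s\<close> to an in-neighbour
    \<open>w\<close> would close the triangle \<open>x -> s -> w -> x\<close>.\<close>
  moreover have "arcs_from_to S (T \<union> S) = 0"
    by (intro arcs_from_to_zero) (auto simp: T_def S_def in_only_def digon_nbrs_def dest: no_C3)
  ultimately show ?thesis
    unfolding energy_def 1 2 by simp
qed

text \<open>A Mantel-type bound, proved by deleting digons: a digon and any other vertex share at
  most two arcs, and without digons each pair carries at most one. The left side is even, so an odd
  square can be lowered by one.\<close>

lemma two_arcs_le:
  assumes "finite V"
  shows "2 * arcs_from_to V V \<le> int (card V) ^ 2 - int (card V) mod 2"
proof -
  have "2 * arcs_from_to V V \<le> int (card V) ^ 2"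
    using assms
  proof (induction "card V" arbitrary: V rule: less_induct)
    case less
    show ?case
    proof (cases "\<exists>x\<in>V. \<exists>y\<in>V. (x, y) \<in> E \<and> (y, x) \<in> E")
      case True
      then obtain x y where xy: "x \<in> V" "y \<in> V" "(x, y) \<in> E" "(y, x) \<in> E" by blast
      define U where "U = V - {x, y}"
      have neq: "x \<noteq> y" using xy irrefl by blast
      have U: "finite U" "x \<notin> U" "y \<notin> U" "V = {x, y} \<union> U"
        using less.prems xy by (auto simp: U_def)
      have cV: "card V = card U + 2" using U neq by simp
      have "arcs_from_to V V = arcs_from_to U U + arcs_from_to {x, y} {x, y}
          + (arcs_from_to {x, y} U + arcs_from_to U {x, y})"
        using U by (simp add: arcs_from_to_Un_left arcs_from_to_Un_right del: Un_insert_left)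
      also have "arcs_from_to {x, y} {x, y} = 2"
        using neq xy irrefl by (simp add: arcs_from_to_def)
      also have "arcs_from_to {x, y} U + arcs_from_to U {x, y}
          = (\<Sum>z\<in>U. arc x z + arc y z + arc z x + arc z y)"
        using neq by (simp add: arcs_from_to_def sum.distrib)
      also have "\<dots> \<le> (\<Sum>z\<in>U. 2)"
      proof (intro sum_mono)
        fix z
        \<comment> \<open>Each of the paths \<open>x -> z -> y\<close> and
          \<open>y -> z -> x\<close> would close a triangle with the digon, so at most one arc of
          each is present.\<close>
        show "arc x z + arc y z + arc z x + arc z y \<le> 2"
          using no_C3[of x y z] no_C3[of y x z] xy by (auto simp: arc_def)
      qed
      finally have "arcs_from_to V V \<le> arcs_from_to U U + 2 + 2 * int (card U)" by simp
      moreover have "2 * arcs_from_to U U \<le> int (card U) ^ 2"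
        using less.hyps[of U] U(1) cV by simp
      ultimately show ?thesis
        unfolding cV by (simp add: power2_eq_square algebra_simps)
    next
      case False
      have "2 * arcs_from_to V V = (\<Sum>x\<in>V. \<Sum>y\<in>V. arc x y) + (\<Sum>y\<in>V. \<Sum>x\<in>V. arc x y)"
        unfolding arcs_from_to_def by (subst (2) sum.swap) simp
      also have "\<dots> = (\<Sum>x\<in>V. \<Sum>y\<in>V. arc x y + arc y x)"
        by (simp add: sum.distrib)
      also have "\<dots> \<le> (\<Sum>x\<in>V. \<Sum>y\<in>V. 1)"
        using False by (intro sum_mono) (auto simp: arc_def)
      also have "\<dots> = int (card V) ^ 2" by (simp add: power2_eq_square)
      finally show ?thesis .
    qed
  qed
  moreover obtain k where "int (card V) ^ 2 - int (card V) mod 2 = 2 * k"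
    using evenE[of "int (card V) ^ 2 - int (card V) mod 2"] by auto
  moreover have "int (card V) mod 2 \<le> 1" by simp
  ultimately have "arcs_from_to V V \<le> k" and "int (card V) ^ 2 - int (card V) mod 2 = 2 * k"
    by linarith+
  then show ?thesis by linarith
qed

text \<open>The digon is rebuilt in two steps, first \<open>y\<close> over \<open>U\<close>, then
  \<open>x\<close> over \<open>insert y U\<close>. In the second step \<open>y\<close> is itself a
  digon neighbour of \<open>x\<close>, whence the terms \<open>c + 1\<close>. All estimates keep
  their slack, so a maximal increment turns them into equalities.\<close>

lemma digon_removal:
  assumes fin: "finite U" and xU: "x \<notin> U" and yU: "y \<notin> U" and xy: "(x, y) \<in> E" "(y, x) \<in> E"
  defines "V \<equiv> insert x (insert y U)"
  shows "energy V \<le> energy U + 2 * (int (card U) + 1)\<^sup>2 + 2" (is ?bound)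
    and "energy V = energy U + 2 * (int (card U) + 1)\<^sup>2 + 2 \<Longrightarrow>
      \<exists>P B Q. V = P \<union> B \<union> Q \<and> P \<inter> B = {} \<and> P \<inter> Q = {} \<and> B \<inter> Q = {} \<and>
        block B \<and> card B \<in> {2, 3, 4} \<and> even (card P) \<and> dominates P (B \<union> Q) \<and> dominates B Q"
      (is "?tight \<Longrightarrow> ?structure")
proof -
  define Tx Ty Ox Oy Sx Sy where "Tx = in_only U x" and "Ty = in_only U y"
    and "Ox = out_only U x" and "Oy = out_only U y"
    and "Sx = digon_nbrs U x" and "Sy = digon_nbrs U y"
  note defs = Tx_def Ty_def Ox_def Oy_def Sx_def Sy_def in_only_def out_only_def digon_nbrs_def
  define P Q where "P = Tx \<union> Ty" and "Q = Ox \<union> Oy"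
  have neq: "x \<noteq> y" using xy irrefl by blast
  have sub: "Tx \<subseteq> U" "Ty \<subseteq> U" "Ox \<subseteq> U" "Oy \<subseteq> U" "Sx \<subseteq> U" "Sy \<subseteq> U"
    by (auto simp: defs)
  have finS [simp]: "finite Tx" "finite Ty" "finite Ox" "finite Oy" "finite Sx" "finite Sy"
    "finite P" "finite Q"
    using sub fin by (auto simp: P_def Q_def intro: finite_subset)
  \<comment> \<open>Sets belonging to the same end are disjoint by definition; a vertex common to
    sets of different ends would close a triangle with the digon.\<close>
  have disj: "P \<inter> Q = {}" "P \<inter> (Sx \<union> Sy) = {}" "Q \<inter> (Sx \<union> Sy) = {}" "Sx \<inter> Sy = {}"
    using xy no_C3 unfolding P_def Q_def defs by blast+
  have disjx: "Tx \<inter> Sx = {}" "Ty \<inter> Sy = {}"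
    by (auto simp: defs)
  define a b g d p q c h m where "a = int (card Tx)" and "b = int (card Ty)"
    and "g = int (card Ox)" and "d = int (card Oy)" and "p = int (card P)" and "q = int (card Q)"
    and "c = int (card Sx)" and "h = int (card Sy)" and "m = int (card U)"
  note nums = a_def b_def g_def d_def p_def q_def c_def h_def m_def
  have PQS: "card (P \<union> Q \<union> (Sx \<union> Sy)) = card P + card Q + (card Sx + card Sy)"
    using disj by (simp add: card_Un_disjoint Int_Un_distrib2)
  have PQSU: "P \<union> Q \<union> (Sx \<union> Sy) \<subseteq> U" using sub by (auto simp: P_def Q_def)
  have le: "a \<le> p" "b \<le> p" "g \<le> q" "d \<le> q" "p + q + c + h \<le> m"
    using card_mono[OF fin PQSU] PQS unfolding nums
    by (auto intro!: card_mono simp: P_def Q_def)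
  have nonneg: "0 \<le> a" "0 \<le> b" "0 \<le> g" "0 \<le> d" "0 \<le> c" "0 \<le> h"
    by (auto simp: nums)

  \<comment> \<open>The vertices left after the in-neighbours of \<open>x\<close> and of
    \<open>y\<close>; \<open>y\<close> drops out of \<open>R1\<close>, so its size is
    \<open>m - a - c\<close>.\<close>
  define R1 R2 where "R1 = insert y U - Tx - insert y Sx" and "R2 = U - Ty - Sy"
  have finR: "finite R1" "finite R2" using fin by (auto simp: R1_def R2_def)
  have cR1: "int (card R1) = m - a - c"
  proof -
    have "R1 = U - (Tx \<union> Sx)" using yU sub by (auto simp: R1_def)
    moreover have "card (Tx \<union> Sx) = card Tx + card Sx" using disjx by (intro card_Un_disjoint) auto
    moreover have "card (Tx \<union> Sx) \<le> card U" using sub fin by (intro card_mono) auto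
    ultimately show ?thesis
      using sub by (simp add: card_Diff_subset nums)
  qed
  have cR2: "int (card R2) = m - b - h"
  proof -
    have "R2 = U - (Ty \<union> Sy)" by (auto simp: R2_def)
    moreover have "card (Ty \<union> Sy) = card Ty + card Sy" using disjx by (intro card_Un_disjoint) auto
    moreover have "card (Ty \<union> Sy) \<le> card U" using sub fin by (intro card_mono) auto
    ultimately show ?thesis
      using sub by (simp add: card_Diff_subset nums)
  qed
  have yS: "y \<notin> Sx" "y \<notin> Tx" using sub yU by auto
  have cS: "int (card (insert y Sx)) = c + 1" using yS by (simp add: nums)
  have ins: "in_only (insert y U) x = Tx" "digon_nbrs (insert y U) x = insert y Sx"
    "out_only (insert y U) x = Ox"
    using xy by (auto simp: defs)

  have deg: "(\<Sum>z\<in>insert y U. arc x z) = g + c + 1" "(\<Sum>z\<in>U. arc y z) = d + h"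
    using out_degree_split[of "insert y U" x] out_degree_split[OF fin, of y] fin cS
    by (simp_all only: finite_insert ins) (simp_all add: nums Oy_def Sy_def)
  have e1: "energy V = energy (insert y U) + (g + c + 1)\<^sup>2 + 2 * (c + 1) + (a + (c + 1))
      + 2 * arcs_from_to Tx Tx + 2 * arcs_from_to Tx (insert y Sx)
      + 2 * arcs_from_to (Tx \<union> insert y Sx) R1"
    using energy_insert[of "insert y U" x] fin xU neq
    by (simp only: V_def ins deg cS R1_def finite_insert insert_iff a_def[symmetric]) simp
  have e2: "energy (insert y U) = energy U + (d + h)\<^sup>2 + 2 * h + (b + h)
      + 2 * arcs_from_to Ty Ty + 2 * arcs_from_to Ty Sy + 2 * arcs_from_to (Ty \<union> Sy) R2"
    using energy_insert[OF fin yU] deg by (simp add: R2_def Ty_def Sy_def b_def h_def)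

  have tt: "2 * arcs_from_to Tx Tx \<le> a\<^sup>2 - a mod 2" "2 * arcs_from_to Ty Ty \<le> b\<^sup>2 - b mod 2"
    using two_arcs_le by (simp_all add: nums)
  have ts: "arcs_from_to Tx (insert y Sx) \<le> a * (c + 1)" "arcs_from_to Ty Sy \<le> b * h"
    using arcs_from_to_le[of Tx "insert y Sx"] arcs_from_to_le[of Ty Sy] cS by (simp_all add: nums)
  have cTS: "int (card (Tx \<union> insert y Sx)) = a + (c + 1)" "int (card (Ty \<union> Sy)) = b + h"
  proof -
    have "card (Tx \<union> insert y Sx) = card Tx + card (insert y Sx)" "card (Ty \<union> Sy) = card Ty + card Sy"
      using disjx yS by (auto intro!: card_Un_disjoint)
    then show "int (card (Tx \<union> insert y Sx)) = a + (c + 1)" "int (card (Ty \<union> Sy)) = b + h"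
      using cS by (simp_all add: nums)
  qed
  have tr: "arcs_from_to (Tx \<union> insert y Sx) R1 \<le> (a + (c + 1)) * (m - a - c)"
    "arcs_from_to (Ty \<union> Sy) R2 \<le> (b + h) * (m - b - h)"
    using arcs_from_to_le[of "Tx \<union> insert y Sx" R1] arcs_from_to_le[of "Ty \<union> Sy" R2]
    unfolding cTS cR1 cR2 .
  have sq: "0 \<le> z * (z - 1)" if "0 \<le> z" for z :: int
    using that by (cases "z = 0") auto
  note [simp] = nonneg
  \<comment> \<open>\<open>s1\<close> to \<open>s6\<close> are deficits of arc counts, while
    \<open>s7\<close> and \<open>s8\<close> vanish only if \<open>c\<close> and \<open>h\<close> are
    0 or 1. Keeping \<open>a mod 2\<close> as a lower bound of \<open>s1\<close> later makes
    \<open>P\<close> even.\<close>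
  define s1 s2 s3 s4 s5 s6 s7 s8 where "s1 = a\<^sup>2 - 2 * arcs_from_to Tx Tx"
    and "s2 = b\<^sup>2 - 2 * arcs_from_to Ty Ty"
    and "s3 = a * (c + 1) - arcs_from_to Tx (insert y Sx)" and "s4 = b * h - arcs_from_to Ty Sy"
    and "s5 = (a + (c + 1)) * (m - a - c) - arcs_from_to (Tx \<union> insert y Sx) R1"
    and "s6 = (b + h) * (m - b - h) - arcs_from_to (Ty \<union> Sy) R2"
    and "s7 = c * (c - 1)" and "s8 = h * (h - 1)"
  note slack_defs = s1_def s2_def s3_def s4_def s5_def s6_def s7_def s8_def
  have slack: "a mod 2 \<le> s1" "0 \<le> a mod 2" "0 \<le> s2" "0 \<le> s3" "0 \<le> s4" "0 \<le> s5" "0 \<le> s6"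
    "0 \<le> s7" "0 \<le> s8"
    using tt ts tr sq pos_mod_sign[of 2 b] by (auto simp: slack_defs)
  have total: "energy V + s1 + s2 + 2 * s3 + 2 * s4 + 2 * s5 + 2 * s6
      + (p - a) + (p - b) + (q - g) + (q - d) + (m - (p + q + c + h)) + s7 + s8
    \<le> energy U + (2 * (m + 1)\<^sup>2 + 2)"
    using digon_increment_bound[OF nonneg le] unfolding e1 e2 slack_defs
    by (simp add: algebra_simps)
  show ?bound
    using total slack le unfolding m_def[symmetric] by linarith
  assume ?tight
  then have tight: "energy V = energy U + (2 * (m + 1)\<^sup>2 + 2)" by (simp add: m_def)
  \<comment> \<open>Slacks and gaps are nonnegative with total at most 0, so each of them
    vanishes.\<close>
  have par0: "a mod 2 = 0" and gaps: "a = p" "b = p" "g = q" "d = q" "p + q + c + h = m"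
    and "s3 = 0" "s5 = 0" "s6 = 0" "s7 = 0" "s8 = 0"
    using total slack le unfolding tight by linarith+
  then have full: "arcs_from_to Tx (insert y Sx) = a * (c + 1)"
      "arcs_from_to (Tx \<union> insert y Sx) R1 = (a + (c + 1)) * (m - a - c)"
      "arcs_from_to (Ty \<union> Sy) R2 = (b + h) * (m - b - h)"
    and c0: "c * (c - 1) = 0" and h0: "h * (h - 1) = 0"
    by (simp_all add: slack_defs)
  have cards: "card Tx = card P" "card Ty = card P" "card Ox = card Q" "card Oy = card Q"
    "card (P \<union> Q \<union> (Sx \<union> Sy)) = card U"
    using gaps PQS unfolding nums by linarith+
  have "Tx \<subseteq> P" "Ty \<subseteq> P" "Ox \<subseteq> Q" "Oy \<subseteq> Q" by (auto simp: P_def Q_def)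
  then have eqs: "Tx = P" "Ty = P" "Ox = Q" "Oy = Q" "P \<union> Q \<union> (Sx \<union> Sy) = U"
    using cards card_subset_eq[OF _ _ cards(1)] card_subset_eq[OF _ _ cards(2)]
      card_subset_eq[OF _ _ cards(3)] card_subset_eq[OF _ _ cards(4)]
      card_subset_eq[OF fin PQSU cards(5)] by simp_all
  have c1: "card Sx \<le> 1" "card Sy \<le> 1" using c0 h0 by (auto simp: nums)
  have S_no: "\<And>z w. z \<in> Sx \<Longrightarrow> w \<in> Sx \<Longrightarrow> z = w" "\<And>z w. z \<in> Sy \<Longrightarrow> w \<in> Sy \<Longrightarrow> z = w"
    using c1 by (auto simp: card_le_Suc0_iff_eq)
  have F1: "Tx \<times> insert y Sx \<subseteq> E"
    using full(1) cS by (intro full_if_arcs_from_to_eq) (auto simp: nums)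
  have F2: "(Tx \<union> insert y Sx) \<times> R1 \<subseteq> E"
    using full(2) cTS cR1 finR by (intro full_if_arcs_from_to_eq) auto
  have F3: "(Ty \<union> Sy) \<times> R2 \<subseteq> E"
    using full(3) cTS cR2 finR by (intro full_if_arcs_from_to_eq) auto
  \<comment> \<open>Since \<open>P\<close>, \<open>Q\<close>, \<open>Sx\<close>, \<open>Sy\<close>
    exhaust \<open>U\<close>, what lies beyond the in-neighbours of one end is \<open>Q\<close> and
    the digon neighbours of the other.\<close>
  have R: "R1 = Q \<union> Sy" "R2 = Q \<union> Sx"
    using eqs disj yU unfolding R1_def R2_def by blast+
  \<comment> \<open>The sides are crossed: \<open>x\<close> joins the digon neighbours of
    \<open>y\<close>, to which it cannot be adjacent without a triangle, and likewise for
    \<open>y\<close>.\<close>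
  define X Y where "X = insert x Sy" and "Y = insert y Sx"
  have PB: "P \<times> (X \<union> Y \<union> Q) \<subseteq> E"
    using F1 F2 R eqs unfolding X_def Y_def by (auto simp: defs)
  have BQ: "(X \<union> Y) \<times> Q \<subseteq> E"
    using F2 F3 R eqs unfolding X_def Y_def by (auto simp: defs)
  \<comment> \<open>Between \<open>Sx\<close> and \<open>Sy\<close>, one direction comes from
    \<open>F2\<close> and the other from \<open>F3\<close>.\<close>
  have XY: "X \<times> Y \<union> Y \<times> X \<subseteq> E"
    using F2 F3 R xy unfolding X_def Y_def by (auto simp: defs)
  have Sx_no: "(y, z) \<notin> E" "(z, y) \<notin> E" if "z \<in> Sx" for z
    using that xy no_C3[of y z x] no_C3[of z y x] by (auto simp: Sx_def digon_nbrs_def)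
  have Sy_no: "(x, z) \<notin> E" "(z, x) \<notin> E" if "z \<in> Sy" for z
    using that xy no_C3[of x z y] no_C3[of z x y] by (auto simp: Sy_def digon_nbrs_def)
  have "(z, w) \<notin> E" if "z \<in> X" "w \<in> X" for z w
    using that Sy_no S_no(2)[of z w] irrefl by (auto simp: X_def)
  then have XX: "X \<times> X \<inter> E = {}" by auto
  have "(z, w) \<notin> E" if "z \<in> Y" "w \<in> Y" for z w
    using that Sx_no S_no(1)[of z w] irrefl by (auto simp: Y_def)
  then have YY: "Y \<times> Y \<inter> E = {}" by auto
  have mem: "x \<in> X" "y \<in> Y" by (simp_all add: X_def Y_def)
  \<comment> \<open>A backward arc at a vertex of the block closes a triangle through
    \<open>x\<close> or \<open>y\<close>, whichever lies on the opposite side.\<close>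
  have "(w, z) \<notin> E" if "w \<in> X \<union> Y" "z \<in> P" for w z
    using that PB XY mem no_C3[of z x w] no_C3[of z y w] by auto
  then have "(X \<union> Y) \<times> P \<inter> E = {}" by auto
  moreover have "(w, z) \<notin> E" if "w \<in> Q" "z \<in> P" for w z
    using that PB BQ mem no_C3[of z x w] by auto
  then have "Q \<times> P \<inter> E = {}" by auto
  moreover have "(w, z) \<notin> E" if "w \<in> Q" "z \<in> X \<union> Y" for w z
    using that BQ XY mem no_C3[of z x w] no_C3[of z y w] by auto
  then have "Q \<times> (X \<union> Y) \<inter> E = {}" by auto
  ultimately have dom: "dominates P (X \<union> Y \<union> Q)" "dominates (X \<union> Y) Q"
    using PB BQ unfolding dominates_def by blast+
  have XYd: "X \<inter> Y = {}"
    using disj(4) neq xU yU sub unfolding X_def Y_def by blast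
  have cX: "card X = card Sy + 1" "card Y = card Sx + 1"
    using xU yU sub by (auto simp: X_def Y_def card_insert_if)
  have cB: "card (X \<union> Y) = card X + card Y"
    using XYd by (intro card_Un_disjoint) (auto simp: X_def Y_def)
  have EB: "E \<inter> (X \<union> Y) \<times> (X \<union> Y) = X \<times> Y \<union> Y \<times> X"
    using XX YY XY by auto
  have bal: "\<bar>int (card X) - int (card Y)\<bar> \<le> 1"
    unfolding cX using c1 by linarith
  have "finite (X \<union> Y)" by (simp add: X_def Y_def)
  then have blk: "block (X \<union> Y)"
    unfolding block_def using EB bal XYd by blast
  have "card (X \<union> Y) = 2 \<or> card (X \<union> Y) = 3 \<or> card (X \<union> Y) = 4"
    unfolding cB cX using c1 by linarith
  then have cB4: "card (X \<union> Y) \<in> {2, 3, 4}" by simp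
  have evP: "even (card P)" using par0 gaps(1) unfolding p_def by presburger
  have Veq: "V = P \<union> (X \<union> Y) \<union> Q"
    unfolding V_def X_def Y_def eqs(5)[symmetric] by auto
  have PU: "P \<subseteq> U" "Q \<subseteq> U" using eqs(5) by auto
  have PB0: "P \<inter> (X \<union> Y) = {}" and BQ0: "(X \<union> Y) \<inter> Q = {}"
    using disj(2,3) PU xU yU unfolding X_def Y_def by auto
  show ?structure
    by (intro exI[of _ P] exI[of _ "X \<union> Y"] exI[of _ Q] conjI)
      (fact Veq PB0 disj(1) BQ0 blk cB4 evP dom)+
qed

text \<open>A new vertex with \<open>t\<close> in-neighbours raises the energy by at most
  \<open>N^2 + t\<close>, hence by at most \<open>N^2 + N\<close>, and these sum to
  \<open>(n^3 - n) / 3\<close>. That is \<open>n - n mod 2\<close> below the extremal value, a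
  positive gap once \<open>n > 1\<close>.\<close>

lemma energy_no_digon:
  assumes "finite V" "\<And>x y. x \<in> V \<Longrightarrow> y \<in> V \<Longrightarrow> (x, y) \<in> E \<Longrightarrow> (y, x) \<notin> E"
  shows "3 * energy V \<le> int (card V) ^ 3 - int (card V)"
  using assms
proof (induction V rule: finite_induct)
  case empty
  then show ?case by (simp add: energy_def)
next
  case (insert x U)
  define T where "T = in_only U x"
  define N t d where "N = int (card U)" and "t = int (card T)" and "d = int (card (out_only U x))"
  have S: "digon_nbrs U x = {}"
    using insert.prems by (auto simp: digon_nbrs_def)
  have fin: "finite T" "finite (out_only U x)" "T \<subseteq> U"
    using insert.hyps(1) by (auto simp: T_def in_only_def out_only_def)
  have "card (T \<union> out_only U x) = card T + card (out_only U x)"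
    using fin by (intro card_Un_disjoint) (auto simp: T_def in_only_def out_only_def)
  moreover have "card (T \<union> out_only U x) \<le> card U"
    using insert.hyps(1) by (intro card_mono) (auto simp: T_def in_only_def out_only_def)
  ultimately have td: "t + d \<le> N" "0 \<le> t" "0 \<le> d" by (simp_all add: N_def t_def d_def)
  have "energy (insert x U) = energy U + d\<^sup>2 + t + 2 * arcs_from_to T T + 2 * arcs_from_to T (U - T)"
    using energy_insert[OF insert.hyps(1,2)] out_degree_split[OF insert.hyps(1), of x] S
    by (simp add: T_def t_def d_def arcs_from_to_def)
  moreover have "2 * arcs_from_to T T \<le> t\<^sup>2"
    using two_arcs_le[OF fin(1)] pos_mod_sign[of 2 t] unfolding t_def by linarith
  moreover have "arcs_from_to T (U - T) \<le> t * (N - t)"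
    using arcs_from_to_le[of T "U - T"] fin insert.hyps(1) card_mono[of U T]
    by (simp add: card_Diff_subset t_def N_def)
  moreover have "d\<^sup>2 \<le> (N - t)\<^sup>2"
    using td by (intro power_mono) auto
  moreover have "(N - t)\<^sup>2 + t + t\<^sup>2 + 2 * (t * (N - t)) = N\<^sup>2 + t"
    by (simp add: power2_eq_square algebra_simps)
  ultimately have "energy (insert x U) \<le> energy U + N\<^sup>2 + N"
    using td by linarith
  moreover have "3 * energy U \<le> N ^ 3 - N"
    using insert unfolding N_def by blast
  moreover have "int (card (insert x U)) = N + 1"
    using insert.hyps by (simp add: N_def)
  moreover have "(N + 1) ^ 3 - (N + 1) = N ^ 3 - N + 3 * N\<^sup>2 + 3 * N"
    by (simp add: power2_eq_square power3_eq_cube algebra_simps)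
  ultimately show ?case by simp
qed

section \<open>The upper bound and its equality case, by induction over digon removals\<close>

lemma obtain_digon_removal:
  assumes "finite V" "x \<in> V" "y \<in> V" "(x, y) \<in> E" "(y, x) \<in> E"
  obtains U where "finite U" "x \<notin> U" "y \<notin> U" "V = insert x (insert y U)" "card V = card U + 2"
proof
  have "x \<noteq> y" using assms irrefl by blast
  show "finite (V - {x, y})" "x \<notin> V - {x, y}" "y \<notin> V - {x, y}"
    "V = insert x (insert y (V - {x, y}))"
    using assms by auto
  then show "card V = card (V - {x, y}) + 2"
    using \<open>x \<noteq> y\<close> by (metis Suc_1 add_2_eq_Suc' card_insert_disjoint finite_insert insert_iff)
qed

lemma energy_bound_add_2:
  "energy_bound (m + 2) = energy_bound m + 6 * (m + 1)\<^sup>2 + 6"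
  unfolding energy_bound_def by (simp add: power2_eq_square power3_eq_cube algebra_simps)

lemma energy_le:
  "finite V \<Longrightarrow> 3 * energy V \<le> energy_bound (int (card V))"
proof (induction "card V" arbitrary: V rule: less_induct)
  case less
  show ?case
  proof (cases "\<exists>x\<in>V. \<exists>y\<in>V. (x, y) \<in> E \<and> (y, x) \<in> E")
    case True
    then obtain x y where xy: "x \<in> V" "y \<in> V" "(x, y) \<in> E" "(y, x) \<in> E" by blast
    from obtain_digon_removal[OF less.prems xy] obtain U where
      U: "finite U" "x \<notin> U" "y \<notin> U" "V = insert x (insert y U)" "card V = card U + 2" .
    have c: "int (card V) = int (card U) + 2" using U(5) by simp
    have "3 * energy U \<le> energy_bound (int (card U))"
      using less.hyps U by simp
    then show ?thesis
      using digon_removal(1)[OF U(1-3) xy(3,4)] energy_bound_add_2[of "int (card U)"]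
      unfolding c U(4)[symmetric] by linarith
  next
    case False
    then have "3 * energy V \<le> int (card V) ^ 3 - int (card V)"
      using energy_no_digon[OF less.prems] by blast
    moreover have "int (card V) mod 2 \<le> int (card V)" by (intro zmod_le_nonneg_dividend) simp
    ultimately show ?thesis unfolding energy_bound_def by linarith
  qed
qed

text \<open>Tightness at a digon splits \<open>V\<close> into \<open>P\<close>, \<open>B\<close>,
  \<open>Q\<close>. Expanding the energy of this ordered sum bounds the energies of \<open>P\<close>
  and \<open>Q\<close> together from below by the sum of their maxima, so both are tight and the
  induction hypothesis applies.\<close>

lemma block_chain_if_tight:
  "finite V \<Longrightarrow> 3 * energy V = energy_bound (int (card V))
    \<Longrightarrow> block_chain V"
proof (induction "card V" arbitrary: V rule: less_induct)
  case less
  show ?case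
  proof (cases "\<exists>x\<in>V. \<exists>y\<in>V. (x, y) \<in> E \<and> (y, x) \<in> E")
    case True
    then obtain x y where xy: "x \<in> V" "y \<in> V" "(x, y) \<in> E" "(y, x) \<in> E" by blast
    from obtain_digon_removal[OF less.prems(1) xy] obtain U where
      U: "finite U" "x \<notin> U" "y \<notin> U" "V = insert x (insert y U)" "card V = card U + 2" .
    have c: "int (card V) = int (card U) + 2" using U(5) by simp
    \<comment> \<open>The energy of \<open>U\<close> is at most its own bound, so the increment must
      be the maximal one.\<close>
    have "energy V = energy U + 2 * (int (card U) + 1)\<^sup>2 + 2"
      using digon_removal(1)[OF U(1-3) xy(3,4)] energy_bound_add_2[of "int (card U)"] less.prems(2)
        energy_le[OF U(1)]
      unfolding c U(4)[symmetric] by linarith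
    from digon_removal(2)[OF U(1-3) xy(3,4), folded U(4), OF this]
    obtain P B Q where V: "V = P \<union> B \<union> Q" and disj: "P \<inter> B = {}" "P \<inter> Q = {}" "B \<inter> Q = {}"
      and B: "block B" "card B \<in> {2, 3, 4}" and P: "even (card P)"
      and dom: "dominates P (B \<union> Q)" "dominates B Q"
      by blast
    have fin: "finite P" "finite B" "finite Q" using less.prems(1) V by auto
    define p b r where "p = int (card P)" and "b = int (card B)" and "r = int (card Q)"
    have cBQ: "int (card (B \<union> Q)) = b + r"
      using fin disj by (simp add: card_Un_disjoint b_def r_def)
    have cV: "card V = card P + card B + card Q"
      using fin disj unfolding V by (simp add: card_Un_disjoint Int_Un_distrib2)
    then have cV': "int (card V) = p + b + r" by (simp add: p_def b_def r_def)
    have mp: "p mod 2 = 0" using P unfolding p_def by presburger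
    have eP: "3 * energy P \<le> p ^ 3 + 2 * p"
      using energy_le[OF fin(1)] mp unfolding p_def energy_bound_def by simp
    have eQ: "3 * energy Q \<le> r ^ 3 + 2 * r - 3 * (r mod 2)"
      using energy_le[OF fin(3)] unfolding r_def energy_bound_def by simp
    have b4: "card B \<in> {1, 2, 3, 4}" using B(2) by auto
    note bE = block_energy[OF B(1) b4, folded b_def]
    have f1: "energy V = energy P + 2 * (b + r) * arcs_from_to P P + p * (b + r)\<^sup>2 + energy (B \<union> Q)"
      using energy_ordered_sum[OF fin(1) _ _ dom(1)] fin disj cBQ
      unfolding V Un_assoc p_def by (simp add: Int_Un_distrib)
    have f2: "energy (B \<union> Q) = energy B + 2 * r * arcs_from_to B B + b * r\<^sup>2 + energy Q"
      using energy_ordered_sum[OF fin(2,3) disj(3) dom(2)] unfolding b_def r_def .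
    have f3: "2 * (b + r) * arcs_from_to P P \<le> (b + r) * p\<^sup>2"
    proof -
      have "2 * arcs_from_to P P \<le> p\<^sup>2"
        using two_arcs_le[OF fin(1)] mp unfolding p_def by simp
      moreover have "0 \<le> b + r" by (simp add: b_def r_def)
      ultimately have "(b + r) * (2 * arcs_from_to P P) \<le> (b + r) * p\<^sup>2"
        by (rule mult_left_mono)
      then show ?thesis by (simp only: ac_simps)
    qed
    have f4: "2 * r * arcs_from_to B B = r * b\<^sup>2 - r * (b mod 2)"
      using arg_cong[OF bE(2), of "\<lambda>z. r * z"] by (simp add: algebra_simps)
    have f5: "3 * energy B = (b ^ 3 + 2 * b) - 3 * (b mod 2)"
      using bE(1) unfolding energy_bound_def .
    have "energy_bound (p + b + r) = (p ^ 3 + 2 * p) + 3 * ((b + r) * p\<^sup>2)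
        + 3 * (p * (b + r)\<^sup>2) + (b ^ 3 + 2 * b) + 3 * (r * b\<^sup>2) + 3 * (b * r\<^sup>2) + (r ^ 3 + 2 * r)
        - 3 * ((p + b + r) mod 2)"
      unfolding energy_bound_def by (simp add: power2_eq_square power3_eq_cube algebra_simps)
    moreover have "(p + b + r) mod 2 = (b + r) mod 2" using mp by presburger
    ultimately have f6: "3 * energy V = (p ^ 3 + 2 * p) + 3 * ((b + r) * p\<^sup>2)
        + 3 * (p * (b + r)\<^sup>2) + (b ^ 3 + 2 * b) + 3 * (r * b\<^sup>2) + 3 * (b * r\<^sup>2) + (r ^ 3 + 2 * r)
        - 3 * ((b + r) mod 2)"
      using less.prems(2) unfolding cV' by simp
    \<comment> \<open>With each monomial read as a variable, \<open>f1\<close> to \<open>f6\<close>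
      combine linearly; the mixed cubic terms cancel and only parity corrections remain.\<close>
    have linear: "p3 + r3 + 3 * m1 + 3 * c5 - 3 * m3 \<le> 3 * eP + 3 * eQ"
      if "eV = eP + u1 + c2 + eBQ" "eBQ = eB + u2 + c4 + eQ" "u1 \<le> c1" "u2 = c3 - c5"
        "3 * eB = b3 - 3 * m1" "3 * eV = p3 + 3 * c1 + 3 * c2 + b3 + 3 * c3 + 3 * c4 + r3 - 3 * m3"
      for eV eP eBQ eB eQ u1 u2 c1 c2 c3 c4 c5 p3 b3 r3 m1 m3 :: int
      using that by linarith
    have key: "(p ^ 3 + 2 * p) + (r ^ 3 + 2 * r) + 3 * (b mod 2) + 3 * (r * (b mod 2))
        - 3 * ((b + r) mod 2) \<le> 3 * energy P + 3 * energy Q"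
      by (rule linear[OF f1 f2 f3 f4 f5 f6])
    have r0: "0 \<le> r" by (simp add: r_def)
    \<comment> \<open>An odd \<open>B\<close> followed by \<open>r > 0\<close> vertices loses
      \<open>r\<close> in the cross term \<open>2 * r * arcs_from_to B B\<close>, and the parity
      corrections cannot make up for it.\<close>
    have cases: "b mod 2 = 0 \<or> b mod 2 = 1 \<and> r = 0"
    proof (rule ccontr)
      assume "\<not> ?thesis"
      then have "b mod 2 = 1" "r > 0" using r0 by auto
      moreover from this have "(b + r) mod 2 = 1 - r mod 2" by presburger
      moreover have "0 \<le> r mod 2" by simp
      ultimately show False using key eP eQ by simp
    qed
    have tP: "3 * energy P = p ^ 3 + 2 * p" and tQ: "3 * energy Q = r ^ 3 + 2 * r - 3 * (r mod 2)"
    proof -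
      have "3 * (b mod 2) + 3 * (r * (b mod 2)) - 3 * ((b + r) mod 2) = - 3 * (r mod 2)"
        using cases
      proof
        assume "b mod 2 = 0"
        moreover from this have "(b + r) mod 2 = r mod 2" by presburger
        ultimately show ?thesis by simp
      qed auto
      then show "3 * energy P = p ^ 3 + 2 * p" "3 * energy Q = r ^ 3 + 2 * r - 3 * (r mod 2)"
        using key eP eQ by linarith+
    qed
    have "card P < card V" "card Q < card V" using cV B(2) by auto
    have cP: "block_chain P"
      using less.hyps[OF \<open>card P < card V\<close> fin(1)] tP mp unfolding p_def energy_bound_def by simp
    have cQ: "block_chain Q"
      using less.hyps[OF \<open>card Q < card V\<close> fin(3)] tQ unfolding r_def energy_bound_def by simp
    have "block_chain (B \<union> Q)"
    proof (cases "card B = 3")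
      case True
      then have "Q = {}" using cases fin by (simp add: b_def r_def)
      then show ?thesis using block_chain.last[OF B(1)] True by simp
    next
      case False
      then show ?thesis using block_chain.step[OF B(1) _ disj(3) dom(2) cQ] B(2) by auto
    qed
    then have "block_chain (P \<union> (B \<union> Q))"
      using block_chain_append[OF cP P _ _ dom(1)] disj by (simp add: Int_Un_distrib)
    then show ?thesis unfolding V Un_assoc .
  next
    case False
    then have "3 * energy V \<le> int (card V) ^ 3 - int (card V)"
      using energy_no_digon[OF less.prems(1)] by blast
    then have "int (card V) \<le> int (card V) mod 2"
      using less.prems(2) unfolding energy_bound_def by linarith
    then have "card V \<le> 1"
      using pos_mod_bound[of 2 "int (card V)"] by linarith
    then consider "V = {}" | v where "V = {v}"
      using less.prems(1) by (metis card_0_eq card_1_singletonE le_less less_one)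
    then show ?thesis
    proof cases
      case 2
      have "block V"
        unfolding block_def 2 using irrefl
        by (intro exI[of _ "{v}"] exI[of _ "{}"]) auto
      then show ?thesis using 2 by (intro block_chain.last) auto
    qed (simp add: block_chain.empty)
  qed
qed

end

section \<open>Chains of blocks: no triangles, and short paths in the underlying graph\<close>

context digraph_rel begin

lemma block_sides:
  assumes "block B"
  obtains X Y where "finite X" "finite Y" "B = X \<union> Y" "X \<inter> Y = {}"
    "\<bar>int (card X) - int (card Y)\<bar> \<le> 1" "E \<inter> B \<times> B = X \<times> Y \<union> Y \<times> X"
  using assms unfolding block_def by auto

text \<open>Arcs between different blocks run only forwards, so a triangle would lie inside one
  block, which is bipartite.\<close>

lemma block_chain_no_C3:
  "block_chain V \<Longrightarrow> x \<in> V \<Longrightarrow> y \<in> V \<Longrightarrow> z \<in> V \<Longrightarrow> (x, y) \<in> E \<Longrightarrow> (y, z) \<in> E \<Longrightarrow> (z, x) \<notin> E"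
proof (induction arbitrary: x y z rule: block_chain.induct)
  case empty
  then show ?case by simp
next
  case (last B)
  from last(1) show ?case
    by (rule block_sides) (use last in blast)
next
  case (step B V)
  have B: "(z, x) \<notin> E" if "x \<in> B" "y \<in> B" "z \<in> B" "(x, y) \<in> E" "(y, z) \<in> E" for x y z
    using step.hyps(1) by (rule block_sides) (use that in blast)
  have VB: "(w, u) \<notin> E" if "w \<in> V" "u \<in> B" for w u
    using step.hyps(4) that by (auto simp: dominates_def)
  show ?case
    using step.prems step.IH[of x y z] B[of x y z] VB[of x y] VB[of y z] VB[of z x] by blast
qed

text \<open>Any two vertices are joined by at most two steps; \<open>z = w\<close> covers adjacent
  ones. Vertices behind the first block have a common in-neighbour in it, and in a block with two
  distinct vertices balance makes both sides nonempty.\<close>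

lemma block_chain_adjacent:
  assumes "block_chain V" "u \<in> V" "w \<in> V" "u \<noteq> w"
  shows "\<exists>z\<in>V. ((u, z) \<in> E \<or> (z, u) \<in> E) \<and> ((z, w) \<in> E \<or> (w, z) \<in> E \<or> z = w)"
proof -
  have in_block: "\<exists>z\<in>B. ((u, z) \<in> E \<or> (z, u) \<in> E) \<and> ((z, w) \<in> E \<or> (w, z) \<in> E \<or> z = w)"
    if B: "block B" and uw: "u \<in> B" "w \<in> B" for B
  proof -
    obtain X Y where XY: "finite X" "finite Y" "B = X \<union> Y" "X \<inter> Y = {}"
      "\<bar>int (card X) - int (card Y)\<bar> \<le> 1" "E \<inter> B \<times> B = X \<times> Y \<union> Y \<times> X"
      using B by (rule block_sides)
    have "2 \<le> card X + card Y"
      using card_mono[of B "{u, w}"] uw assms(4) XY(1,2) unfolding XY(3)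
      using card_Un_disjoint[OF XY(1,2,4)] by simp
    then have "card X \<noteq> 0" "card Y \<noteq> 0" using XY(5) by linarith+
    then obtain x y where "x \<in> X" "y \<in> Y" using XY(1,2) by (auto simp: card_eq_0_iff)
    then have arcs: "X \<times> Y \<subseteq> E" "Y \<times> X \<subseteq> E" using XY(6) by auto
    show ?thesis
      using uw \<open>x \<in> X\<close> \<open>y \<in> Y\<close> arcs unfolding XY(3) by blast
  qed
  show ?thesis
    using assms(1)
  proof cases
    case empty
    then show ?thesis using assms by simp
  next
    case last
    then show ?thesis using in_block assms by blast
  next
    case (step B V')
    have dom: "B \<times> V' \<subseteq> E" using step by (simp add: dominates_def)
    obtain b where b: "b \<in> B" using step(3) by fastforce
    consider "u \<in> B" "w \<in> B" | "u \<in> B" "w \<in> V'" | "u \<in> V'" "w \<in> B" | "u \<in> V'" "w \<in> V'"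
      using assms step(1) by blast
    then show ?thesis
    proof cases
      case 1
      then show ?thesis using in_block[OF step(2)] step(1) by blast
    next
      case 2
      then show ?thesis using dom step(1) by blast
    next
      case 3
      then show ?thesis using dom step(1) by blast
    next
      case 4
      then show ?thesis using dom b step(1) by blast
    qed
  qed
qed

section \<open>Translation between chains of blocks and partitions indexed by
  \<open>{1..p}\<close>\<close>

definition block_seq :: "nat \<Rightarrow> (nat \<Rightarrow> 'a set) \<Rightarrow> 'a set \<Rightarrow> bool" where
  "block_seq p V W \<longleftrightarrow>
     1 \<le> p \<and> (\<Union>i\<in>{1..p}. V i) = W \<and> (\<forall>i\<in>{1..p}. V i \<noteq> {}) \<and>
     disjoint_family_on V {1..p} \<and> (\<forall>i\<in>{1..p}. block (V i)) \<and>
     (\<forall>i j. 1 \<le> i \<and> i < j \<and> j \<le> p \<longrightarrow> dominates (V i) (V j))"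

lemma block_seq_single: "block B \<Longrightarrow> B \<noteq> {} \<Longrightarrow> block_seq 1 (\<lambda>_. B) B"
  by (auto simp: block_seq_def disjoint_family_on_def)

lemma block_seq_Cons:
  assumes B: "block B" "B \<noteq> {}" "B \<inter> W = {}" "dominates B W" and seq: "block_seq p V W"
  shows "block_seq (Suc p) (\<lambda>i. if i \<le> 1 then B else V (i - 1)) (B \<union> W)"
proof -
  define V' where "V' = (\<lambda>i. if i \<le> 1 then B else V (i - 1))"
  have V': "V' (Suc 0) = B" "\<And>i. 1 \<le> i \<Longrightarrow> V' (Suc i) = V i" by (auto simp: V'_def)
  have split: "{1..Suc p} = insert 1 (Suc ` {1..p})"
    by (auto simp: image_iff Bex_def)
  have UN_split: "(\<Union>i\<in>{1..Suc p}. F i) = F 1 \<union> (\<Union>i\<in>{1..p}. F (Suc i))" for F :: "nat \<Rightarrow> 'a set"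
    unfolding split by blast
  have sub: "\<And>i. i \<in> {1..p} \<Longrightarrow> V i \<subseteq> W" using seq by (auto simp: block_seq_def)
  have "block_seq (Suc p) V' (B \<union> W)"
    unfolding block_seq_def
  proof (intro conjI allI impI ballI)
    show "(\<Union>i\<in>{1..Suc p}. V' i) = B \<union> W"
      unfolding UN_split using V' seq by (simp add: block_seq_def)
  next
    fix i assume "i \<in> {1..Suc p}"
    then have "i = 1 \<or> i \<noteq> 1 \<and> i - 1 \<in> {1..p}" by auto
    then have "V' i \<noteq> {} \<and> block (V' i)"
    proof
      assume "i \<noteq> 1 \<and> i - 1 \<in> {1..p}"
      moreover from this have "V' i = V (i - 1)" by (auto simp: V'_def)
      ultimately show ?thesis using seq unfolding block_seq_def by metis
    qed (use B in \<open>simp add: V'_def\<close>)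
    then show "V' i \<noteq> {}" "block (V' i)" by auto
  next
    show "disjoint_family_on V' {1..Suc p}"
      unfolding disjoint_family_on_def
    proof (intro ballI impI)
      fix i j assume ij: "i \<in> {1..Suc p}" "j \<in> {1..Suc p}" "i \<noteq> j"
      then consider "i = 1" "j - 1 \<in> {1..p}" "j = Suc (j - 1)" | "j = 1" "i - 1 \<in> {1..p}" "i = Suc (i - 1)"
        | "i - 1 \<in> {1..p}" "j - 1 \<in> {1..p}" "i = Suc (i - 1)" "j = Suc (j - 1)" "i - 1 \<noteq> j - 1"
        by (cases "i = 1"; cases "j = 1") auto
      then show "V' i \<inter> V' j = {}"
      proof cases
        case 1
        then show ?thesis using sub[of "j - 1"] B(3) by (auto simp: V'_def)
      next
        case 2
        then show ?thesis using sub[of "i - 1"] B(3) by (auto simp: V'_def)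
      next
        case 3
        then have "V (i - 1) \<inter> V (j - 1) = {}"
          using seq unfolding block_seq_def disjoint_family_on_def by blast
        then show ?thesis using 3 by (auto simp: V'_def)
      qed
    qed
  next
    fix i j assume ij: "1 \<le> i \<and> i < j \<and> j \<le> Suc p"
    show "dominates (V' i) (V' j)"
    proof (cases "i = 1")
      case True
      then show ?thesis
        using B(4) sub[of "j - 1"] ij by (force simp: V'_def dominates_def)
    next
      case False
      then have "1 \<le> i - 1 \<and> i - 1 < j - 1 \<and> j - 1 \<le> p" using ij by linarith
      then have "dominates (V (i - 1)) (V (j - 1))"
        using seq unfolding block_seq_def by blast
      then show ?thesis using False ij by (simp add: V'_def)
    qed
  qed simp
  then show ?thesis unfolding V'_def .
qed

lemma block_seq_tail:
  assumes "block_seq (Suc p) V W" "1 \<le> p"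
  defines "W' \<equiv> \<Union>i\<in>{1..p}. V (Suc i)"
  shows "block_seq p (\<lambda>i. V (Suc i)) W'" "W = V 1 \<union> W'" "V 1 \<inter> W' = {}" "dominates (V 1) W'"
    "block (V 1)"
proof -
  note D = assms(1)[unfolded block_seq_def]
  have split: "{1..Suc p} = insert 1 (Suc ` {1..p})"
    by (auto simp: image_iff Bex_def)
  have UN_split: "(\<Union>i\<in>{1..Suc p}. F i) = F 1 \<union> (\<Union>i\<in>{1..p}. F (Suc i))" for F :: "nat \<Rightarrow> 'a set"
    unfolding split by blast
  show "W = V 1 \<union> W'" using D unfolding UN_split W'_def by simp
  show "block (V 1)" using D by simp
  have dis: "V i \<inter> V j = {}" if "i \<in> {1..Suc p}" "j \<in> {1..Suc p}" "i \<noteq> j" for i j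
    using D that unfolding disjoint_family_on_def by blast
  have "V 1 \<inter> V (Suc i) = {}" if "i \<in> {1..p}" for i
    using dis[of 1 "Suc i"] that by simp
  then show "V 1 \<inter> W' = {}" unfolding W'_def by blast
  have "dominates (V 1) (V (Suc i))" if "i \<in> {1..p}" for i
    using D that by auto
  then show "dominates (V 1) W'" unfolding W'_def dominates_def by blast
  show "block_seq p (\<lambda>i. V (Suc i)) W'"
    unfolding block_seq_def disjoint_family_on_def
    using D assms(2) dis by (auto simp: W'_def)
qed

text \<open>Allowing all four sizes for the last block treats both families at once; an even last
  block is a \<open>step\<close> over the empty chain.\<close>

lemma block_chain_if_block_seq:
  assumes "block_seq p V W" "\<forall>i\<in>{1..<p}. card (V i) \<in> {2, 4}" "card (V p) \<in> {1, 2, 3, 4}"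
  shows "block_chain W"
  using assms
proof (induction p arbitrary: V W)
  case 0
  then show ?case by (simp add: block_seq_def)
next
  case (Suc p)
  show ?case
  proof (cases "1 \<le> p")
    case True
    note t = block_seq_tail[OF Suc.prems(1) True]
    have "block_chain (\<Union>i\<in>{1..p}. V (Suc i))"
      using t(1) by (rule Suc.IH) (use Suc.prems(2,3) in auto)
    moreover have "card (V 1) \<in> {2, 4}" using Suc.prems(2) True by simp
    ultimately show ?thesis
      using block_chain.step t by metis
  next
    case False
    then have p: "p = 0" by simp
    have W: "W = V 1" "block (V 1)" using Suc.prems(1) p by (auto simp: block_seq_def)
    have "card (V 1) \<in> {1, 3} \<or> card (V 1) \<in> {2, 4}" using Suc.prems(3) p by auto
    then show ?thesis
    proof
      assume "card (V 1) \<in> {2, 4}"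
      from block_chain.step[OF W(2) this _ _ block_chain.empty] show ?thesis
        unfolding W(1) by (simp add: dominates_def)
    qed (use block_chain.last W in blast)
  qed
qed

text \<open>All blocks but the last are even, so the parity of \<open>card W\<close> fixes that of
  the last one. An indexed sequence has at least one block, hence
  \<open>W \<noteq> {}\<close>.\<close>

lemma block_seq_if_block_chain:
  assumes "block_chain W" "W \<noteq> {}"
  shows "\<exists>p V. block_seq p V W \<and> (\<forall>i\<in>{1..<p}. card (V i) \<in> {2, 4}) \<and>
    card (V p) \<in> (if even (card W) then {2, 4} else {1, 3})"
  using assms
proof (induction rule: block_chain.induct)
  case empty
  then show ?case by simp
next
  case (last B)
  then show ?case
    using block_seq_single[of B] by (intro exI[of _ 1] exI[of _ "\<lambda>_. B"]) auto
next
  case (step B V)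
  have B0: "B \<noteq> {}" using step.hyps(2) by auto
  show ?case
  proof (cases "V = {}")
    case True
    then show ?thesis
      using block_seq_single[OF step.hyps(1) B0] step.hyps(2)
      by (intro exI[of _ 1] exI[of _ "\<lambda>_. B"]) auto
  next
    case False
    then obtain p S where S: "block_seq p S V" "\<forall>i\<in>{1..<p}. card (S i) \<in> {2, 4}"
      "card (S p) \<in> (if even (card V) then {2, 4} else {1, 3})"
      using step.IH by blast
    define S' where "S' = (\<lambda>i. if i \<le> 1 then B else S (i - 1))"
    have p: "1 \<le> p" using S(1) by (simp add: block_seq_def)
    have "block_seq (Suc p) S' (B \<union> V)"
      unfolding S'_def using step.hyps(1) B0 step.hyps(3,4) S(1) by (rule block_seq_Cons)
    moreover have "card (S' i) \<in> {2, 4}" if "i \<in> {1..<Suc p}" for i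
    proof (cases "i = 1")
      case True
      then show ?thesis using step.hyps(2) by (simp add: S'_def)
    next
      case False
      then have "i - 1 \<in> {1..<p}" using that by (simp, linarith)
      then show ?thesis using S(2) False that by (simp add: S'_def)
    qed
    moreover have "card (B \<union> V) = card B + card V"
      using step.hyps block_chain_finite by (intro card_Un_disjoint) (auto simp: block_def)
    then have "even (card (B \<union> V)) = even (card V)" using step.hyps(2) by auto
    then have "card (S' (Suc p)) \<in> (if even (card (B \<union> V)) then {2, 4} else {1, 3})"
      using S(3) p by (simp add: S'_def)
    ultimately show ?thesis by blast
  qed
qed

end

text \<open>The blocks of this witness are the digons on \<open>v (2 * k)\<close> and
  \<open>v (2 * k + 1)\<close>, each dominating all later ones; for odd \<open>n\<close> the last
  vertex stays alone.\<close>

lemma block_chain_exists: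
  fixes v :: "nat \<Rightarrow> 'a"
  assumes inj: "inj_on v {..<n}"
  defines "E \<equiv> {(v i, v j) | i j. i < n \<and> j < n \<and> i \<noteq> j \<and> i div 2 \<le> j div 2}"
  shows "digraph_rel.block_chain E (v ` {..<n})"
proof -
  interpret digraph_rel E .
  have E_iff: "(v i, v j) \<in> E \<longleftrightarrow> i \<noteq> j \<and> i div 2 \<le> j div 2" if "i < n" "j < n" for i j
    using that inj unfolding E_def by (auto dest: inj_onD)
  have v_eq: "v i = v j \<longleftrightarrow> i = j" if "i < n" "j < n" for i j
    using that inj by (auto dest: inj_onD)
  \<comment> \<open>Chains grow at the front, so the claim is generalised to all tails.\<close>
  have "block_chain (v ` {2 * k..<n})" for k
  proof (induction "n - 2 * k" arbitrary: k rule: less_induct)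
    case less
    consider "n \<le> 2 * k" | "n = 2 * k + 1" | "2 * k + 1 < n" by linarith
    then show ?case
    proof cases
      case 1
      then show ?thesis by (simp add: block_chain.empty)
    next
      case 2
      then have "v ` {2 * k..<n} = {v (2 * k)}" by (auto simp: image_iff)
      moreover have "block {v (2 * k)}"
        unfolding block_def using 2 E_iff[of "2 * k" "2 * k"]
        by (intro exI[of _ "{v (2 * k)}"] exI[of _ "{}"]) auto
      ultimately show ?thesis using block_chain.last by simp
    next
      case 3
      define x y where "x = v (2 * k)" and "y = v (2 * k + 1)"
      have neq: "x \<noteq> y" using 3 v_eq by (simp add: x_def y_def)
      have img: "v ` {2 * k..<n} = {x, y} \<union> v ` {2 * Suc k..<n}"
      proof -
        have "{2 * k..<n} = {2 * k, 2 * k + 1} \<union> {2 * Suc k..<n}" using 3 by auto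
        then show ?thesis by (simp add: x_def y_def)
      qed
      have "block {x, y}"
        unfolding block_def using neq 3
        by (intro exI[of _ "{x}"] exI[of _ "{y}"]) (auto simp: x_def y_def E_iff)
      moreover have "card {x, y} \<in> {2, 4}" using neq by simp
      moreover have "{x, y} \<inter> v ` {2 * Suc k..<n} = {}"
        using 3 v_eq by (auto simp: x_def y_def)
      moreover have "dominates {x, y} (v ` {2 * Suc k..<n})"
        unfolding dominates_def using 3 by (auto simp: x_def y_def E_iff)
      moreover have "block_chain (v ` {2 * Suc k..<n})"
        using 3 by (intro less) simp
      ultimately show ?thesis unfolding img by (rule block_chain.step)
    qed
  qed
  from this[of 0] show ?thesis by (simp add: atLeast0LessThan)
qed

section \<open>Digraphs\<close>

text \<open>Without loops the diagonal of the Laplacian holds the outdegrees. Off the diagonal the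
  minus signs of transposed entries cancel, so their product indicates a digon.\<close>

lemma laplacian_energy_eq_energy:
  fixes G :: "'a pair_pre_digraph"
  assumes "pair_digraph G" and W: "pverts G = W" and v: "bij_betw v {..<n} W"
  shows "laplacian_energy n v G = of_int (digraph_rel.energy (parcs G) W)"
proof -
  interpret G: pair_digraph G by fact
  interpret digraph_rel "parcs G" .
  let ?L = "laplacian_mat n v G"
  have fin: "finite W" using W G.pair_finite_verts by simp
  have L: "?L \<in> carrier_mat n n"
    by (auto simp: laplacian_mat_def outdegree_mat_def adjacency_mat_def)
  have deg: "of_nat (out_degree (with_proj G) x) = (\<Sum>y\<in>W. arc x y)" for x
  proof -
    have "out_arcs (with_proj G) x = Pair x ` {y \<in> W. (x, y) \<in> parcs G}"
      using W by (auto simp: out_arcs_def dest: G.in_arcsD2)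
    then have "out_degree (with_proj G) x = card {y \<in> W. (x, y) \<in> parcs G}"
      unfolding out_degree_def by (simp add: card_image inj_on_def)
    then show ?thesis
      using fin by (simp add: arc_def of_bool_def sum.If_cases Int_def)
  qed
  have entry: "?L $$ (i, j) = (if i = j then of_int (\<Sum>y\<in>W. arc (v i) y) else 0) - of_int (arc (v i) (v j))"
    if "i < n" "j < n" for i j
    using that unfolding deg[symmetric]
    by (simp add: laplacian_mat_def outdegree_mat_def adjacency_mat_def arc_def)
  have loop: "arc x x = 0" for x
    using G.no_loops'[of x x] by (auto simp: arc_def)
  have prod: "?L $$ (i, j) * ?L $$ (j, i)
      = (if i = j then of_int ((\<Sum>y\<in>W. arc (v i) y)\<^sup>2) else 0) + of_int (arc (v i) (v j) * arc (v j) (v i))"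
    if "i < n" "j < n" for i j
    using that entry loop by (auto simp: power2_eq_square)
  have reindex: "(\<Sum>i<n. f (v i)) = (\<Sum>x\<in>W. f x)" for f :: "'a \<Rightarrow> int"
    by (rule sum.reindex_bij_betw[OF v])
  have "laplacian_energy n v G = mat_trace (?L * ?L)"
    unfolding laplacian_energy_def by (rule sum_squares_eigenvalues[OF L])
  also have "\<dots> = (\<Sum>i<n. \<Sum>j<n. (if i = j then of_int ((\<Sum>y\<in>W. arc (v i) y)\<^sup>2) else 0)
      + of_int (arc (v i) (v j) * arc (v j) (v i)))"
    unfolding mat_trace_mult[OF L L] by (intro sum.cong refl prod) auto
  also have "\<dots> = of_int ((\<Sum>i<n. (\<Sum>y\<in>W. arc (v i) y)\<^sup>2)
      + (\<Sum>i<n. \<Sum>j<n. arc (v i) (v j) * arc (v j) (v i)))"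
    by (simp add: sum.distrib)
  also have "(\<Sum>i<n. (\<Sum>y\<in>W. arc (v i) y)\<^sup>2) = (\<Sum>x\<in>W. (\<Sum>y\<in>W. arc x y)\<^sup>2)"
    by (rule reindex)
  also have "(\<Sum>i<n. \<Sum>j<n. arc (v i) (v j) * arc (v j) (v i)) = (\<Sum>x\<in>W. \<Sum>y\<in>W. arc x y * arc y x)"
    unfolding reindex[of "\<lambda>y. arc (v _) y * arc y (v _)"] by (rule reindex)
  finally show ?thesis unfolding energy_def .
qed

text \<open>Absence of loops makes the three vertices of a closed walk of length 3 distinct, as
  \<open>G.cycle\<close> demands.\<close>

lemma C3_free_iff:
  fixes G :: "'a pair_pre_digraph"
  assumes "pair_digraph G"
  shows "C3_free G \<longleftrightarrow> c3_free_rel (parcs G)"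
proof -
  interpret G: pair_digraph G by fact
  have cyc: "G.cycle [(x, y), (y, z), (z, x)] \<longleftrightarrow>
      (x, y) \<in> parcs G \<and> (y, z) \<in> parcs G \<and> (z, x) \<in> parcs G" for x y z
    by (auto simp: G.cycle_def G.awalk_def dest: G.in_arcsD1 G.no_loops')
  have "\<exists>x y z. c = [(x, y), (y, z), (z, x)]" if "G.cycle c" "length c = 3" for c
  proof -
    obtain e1 e2 e3 where c: "c = [e1, e2, e3]"
      using \<open>length c = 3\<close> by (auto simp: length_Suc_conv numeral_3_eq_3)
    show ?thesis
      using that(1) unfolding c by (cases e1; cases e2; cases e3) (auto simp: G.cycle_def G.awalk_def)
  qed
  then have "C3_free G \<longleftrightarrow>
      (\<forall>x y z. \<not> ((x, y) \<in> parcs G \<and> (y, z) \<in> parcs G \<and> (z, x) \<in> parcs G))"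
    unfolding C3_free_def using cyc by fastforce
  also have "\<dots> \<longleftrightarrow> c3_free_rel (parcs G)"
    using G.no_loops' unfolding c3_free_rel_def by blast
  finally show ?thesis .
qed

lemma balanced_complete_bipartite_iff_block:
  fixes G :: "'a pair_pre_digraph"
  shows "balanced_complete_bipartite (with_proj G \<restriction> S) \<longleftrightarrow> digraph_rel.block (parcs G) S"
proof -
  have "with_proj G \<restriction> S = with_proj \<lparr>pverts = S, parcs = parcs G \<inter> S \<times> S\<rparr>"
    by (auto simp: induce_subgraph_def with_proj_def)
  then show ?thesis
    unfolding balanced_complete_bipartite_def digraph_rel.block_def
    by (auto simp: complete_bipartite_digraph_pair_def)
qed

lemma BK_partition_iff_block_seq:
  "BK_partition p V G \<longleftrightarrow> digraph_rel.block_seq (parcs G) p V (pverts G)"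
proof -
  have "maps_onto G S T \<longleftrightarrow> digraph_rel.dominates (parcs G) S T" for S T
    unfolding maps_onto_def digraph_rel.dominates_def by blast
  then show ?thesis
    unfolding BK_partition_def digraph_rel.block_seq_def balanced_complete_bipartite_iff_block
    by simp
qed

lemma BK_eq_block_chain:
  fixes W :: "'a set"
  assumes "W \<noteq> {}"
  shows "(if odd (card W) then BK1 W else BK0 W)
    = {G. pair_digraph G \<and> pverts G = W \<and> digraph_rel.block_chain (parcs G) W}"
    (is "?BK = ?chains")
proof (rule subset_antisym; rule subsetI)
  fix G assume "G \<in> ?BK"
  then obtain p V where G: "pair_digraph G" "pverts G = W"
    and V: "digraph_rel.block_seq (parcs G) p V W" "\<forall>i\<in>{1..<p}. card (V i) \<in> {2, 4}"
      "card (V p) \<in> {1, 2, 3, 4}"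
  proof (cases "odd (card W)")
    case True
    with \<open>G \<in> ?BK\<close> that show ?thesis
      unfolding BK1_def BK_partition_iff_block_seq by auto
  next
    case False
    with \<open>G \<in> ?BK\<close> obtain p V where *: "pair_digraph G" "pverts G = W"
      "digraph_rel.block_seq (parcs G) p V W" "\<forall>i\<in>{1..p}. card (V i) \<in> {2, 4}"
      unfolding BK0_def BK_partition_iff_block_seq by auto
    moreover have "1 \<le> p" using *(3) by (simp add: digraph_rel.block_seq_def)
    ultimately have "\<forall>i\<in>{1..<p}. card (V i) \<in> {2, 4}" "card (V p) \<in> {1, 2, 3, 4}"
      using bspec[OF *(4), of p] by auto
    then show ?thesis by (rule that[OF *(1-3)])
  qed
  then show "G \<in> ?chains"
    using digraph_rel.block_chain_if_block_seq by blast
next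
  fix G assume "G \<in> ?chains"
  then have G: "pair_digraph G" "pverts G = W" "digraph_rel.block_chain (parcs G) W" by auto
  from digraph_rel.block_seq_if_block_chain[OF G(3) assms] obtain p V where
    V: "digraph_rel.block_seq (parcs G) p V W" "\<forall>i\<in>{1..<p}. card (V i) \<in> {2, 4}"
      "card (V p) \<in> (if even (card W) then {2, 4} else {1, 3})" by blast
  show "G \<in> ?BK"
  proof (cases "odd (card W)")
    case True
    then show ?thesis
      using G V unfolding BK1_def BK_partition_iff_block_seq by auto
  next
    case False
    have "\<forall>i\<in>{1..p}. card (V i) \<in> {2, 4}"
    proof
      fix i assume "i \<in> {1..p}"
      then show "card (V i) \<in> {2, 4}"
        using V(2,3) False by (cases "i = p") auto
    qed
    then have "G \<in> BK0 W"
      unfolding BK0_def BK_partition_iff_block_seq mem_Collect_eq G(2) using G(1) V(1) by blast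
    then show ?thesis using False by simp
  qed
qed

lemma C3_free_if_block_chain:
  fixes G :: "'a pair_pre_digraph"
  assumes "pair_digraph G" "digraph_rel.block_chain (parcs G) (pverts G)"
  shows "C3_free G"
proof -
  interpret G: pair_digraph G by fact
  show ?thesis
    unfolding C3_free_iff[OF assms(1)]
  proof
    show "(x, x) \<notin> parcs G" for x using G.no_loops' by blast
    show "(z, x) \<notin> parcs G" if "(x, y) \<in> parcs G" "(y, z) \<in> parcs G" for x y z
      using digraph_rel.block_chain_no_C3[OF assms(2) _ _ _ that] that
      by (auto dest: G.in_arcsD1 G.in_arcsD2)
  qed
qed

text \<open>This makes the extremal digraphs the same with and without the requirement of weak
  connectivity. Two steps in the symmetric closure always suffice.\<close>

lemma weakly_connected_if_block_chain:
  fixes G :: "'a pair_pre_digraph"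
  assumes "pair_digraph G" "digraph_rel.block_chain (parcs G) (pverts G)" "pverts G \<noteq> {}"
  shows "weakly_connected G"
proof -
  interpret G: pair_digraph G by fact
  let ?H = "mk_symmetric (with_proj G)"
  interpret H: pair_wf_digraph ?H ..
  have H: "pverts ?H = pverts G" by (simp add: mk_symmetric_def)
  have parcs_H: "parcs ?H = parcs G \<union> (parcs G)\<inverse>"
    by (auto simp: mk_symmetric_def)
  have adj: "u \<rightarrow>\<^sup>*\<^bsub>with_proj ?H\<^esub> w" if "(u, w) \<in> parcs G \<or> (w, u) \<in> parcs G" for u w
  proof -
    have "(u, w) \<in> parcs ?H" using that parcs_H by simp
    then show ?thesis by (rule H.reachable_adjI)
  qed
  have "u \<rightarrow>\<^sup>*\<^bsub>with_proj ?H\<^esub> w" if uw: "u \<in> pverts G" "w \<in> pverts G" for u w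
  proof (cases "u = w")
    case True
    have "u \<in> pverts ?H" using uw H by simp
    then show ?thesis unfolding True[symmetric] by (rule H.reachable_refl)
  next
    case False
    then obtain z where uz: "(u, z) \<in> parcs G \<or> (z, u) \<in> parcs G"
      and zw: "(z, w) \<in> parcs G \<or> (w, z) \<in> parcs G \<or> z = w"
      using digraph_rel.block_chain_adjacent[OF assms(2) uw] by blast
    show ?thesis
    proof (cases "z = w")
      case True
      then show ?thesis using adj[OF uz] by simp
    next
      case False
      then have "(z, w) \<in> parcs G \<or> (w, z) \<in> parcs G" using zw by simp
      from H.reachable_trans[OF adj[OF uz] adj[OF this]] show ?thesis .
    qed
  qed
  then show ?thesis
    using assms(3) H unfolding weakly_connected_def connected_def strongly_connected_def by simp
qed

lemma exists_block_chain_digraph: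
  fixes v :: "nat \<Rightarrow> 'a"
  assumes "bij_betw v {..<n} W"
  shows "\<exists>G. pair_digraph G \<and> pverts G = W \<and> digraph_rel.block_chain (parcs G) W"
proof -
  define E where "E = {(v i, v j) | i j. i < n \<and> j < n \<and> i \<noteq> j \<and> i div 2 \<le> j div 2}"
  have W: "v ` {..<n} = W" and inj: "inj_on v {..<n}"
    using assms by (auto simp: bij_betw_def)
  have E: "E \<subseteq> W \<times> W" unfolding E_def W[symmetric] by auto
  have fin: "finite W" unfolding W[symmetric] by simp
  have "pair_digraph \<lparr>pverts = W, parcs = E\<rparr>"
  proof
    show "finite (parcs \<lparr>pverts = W, parcs = E\<rparr>)"
      using finite_subset[OF E] fin by simp
    show "fst e \<noteq> snd e" if "e \<in> parcs \<lparr>pverts = W, parcs = E\<rparr>" for e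
      using that inj by (auto simp: E_def dest: inj_onD)
  qed (use E fin in auto)
  then show ?thesis
    using block_chain_exists[OF inj] unfolding E_def[symmetric] W
    by (intro exI[of _ "\<lparr>pverts = W, parcs = E\<rparr>"]) simp
qed

theorem theorem1p6:
  fixes n q r :: nat and v :: "nat \<Rightarrow> 'a" and W :: "'a set"
    and \<G> :: "'a pair_pre_digraph set" and M :: real
  assumes "n > 0" and "n = 2 * q + r" and "r \<in> {0, 1}"
    and "bij_betw v {..<n} W"
    and "\<G> = C3_free_digraphs W \<or> \<G> = {G \<in> C3_free_digraphs W. weakly_connected G}"
    and "M = 2 * real q / 3 * (3 * real n ^ 2 - 6 * real q * real n + 4 * real q ^ 2 + 2)"
  shows "(\<exists>G\<in>\<G>. laplacian_energy n v G = complex_of_real M) \<and>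
    (\<forall>G\<in>\<G>. laplacian_energy n v G \<in> \<real> \<and> Re (laplacian_energy n v G) \<le> M) \<and>
    {G \<in> \<G>. laplacian_energy n v G = complex_of_real M} = (if r = 1 then BK1 W else BK0 W)"
proof -
  let ?e = "\<lambda>G. digraph_rel.energy (parcs G) W"
  have card: "card W = n" using bij_betw_same_card[OF assms(4)] by simp
  have fin: "finite W" and ne: "W \<noteq> {}" using card assms(1) card_gt_0_iff by force+
  \<comment> \<open>Substituting \<open>n = 2 * q + r\<close> turns the stated polynomial into a
    third of \<open>n^3 + 2 * n - 3 * r\<close>.\<close>
  have M: "3 * M = of_int (energy_bound (int n))"
    using assms(3) unfolding assms(6,2) energy_bound_def
    by (auto simp: power2_eq_square power3_eq_cube algebra_simps)
  have dig: "pair_digraph G" "pverts G = W" "c3_free_rel (parcs G)" if "G \<in> \<G>" for G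
    using that assms(5) C3_free_iff by (auto simp: C3_free_digraphs_def)
  have le: "laplacian_energy n v G = complex_of_real (of_int (?e G))" if "G \<in> \<G>" for G
    using laplacian_energy_eq_energy[OF dig(1,2)[OF that] assms(4)] by simp
  have tight: "laplacian_energy n v G = complex_of_real M \<longleftrightarrow> 3 * ?e G = energy_bound (int n)"
    if "G \<in> \<G>" for G
  proof -
    have "laplacian_energy n v G = complex_of_real M \<longleftrightarrow> real_of_int (3 * ?e G) = 3 * M"
      unfolding le[OF that] of_real_eq_iff by simp
    then show ?thesis unfolding M of_int_eq_iff .
  qed
  have chain: "3 * ?e G = energy_bound (int n) \<longleftrightarrow> digraph_rel.block_chain (parcs G) W" if "G \<in> \<G>" for G
    using c3_free_rel.block_chain_if_tight[OF dig(3)[OF that] fin]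
      digraph_rel.block_chain_energy[of "parcs G" W] unfolding card by blast
  \<comment> \<open>A nonempty chain is both \<open>C3_free\<close> and weakly connected, so it
    belongs to \<open>\<G>\<close> under either reading.\<close>
  have chain_in: "G \<in> \<G>"
    if "pair_digraph G" "pverts G = W" "digraph_rel.block_chain (parcs G) W" for G
    using assms(5) that ne C3_free_if_block_chain[of G] weakly_connected_if_block_chain[of G]
    by (auto simp: C3_free_digraphs_def)
  have "{G \<in> \<G>. laplacian_energy n v G = complex_of_real M}
      = {G. pair_digraph G \<and> pverts G = W \<and> digraph_rel.block_chain (parcs G) W}"
    using tight chain chain_in dig(1,2) by blast
  also have "\<dots> = (if r = 1 then BK1 W else BK0 W)"
    using BK_eq_block_chain[OF ne] card assms(2,3) by auto
  finally have set: "{G \<in> \<G>. laplacian_energy n v G = complex_of_real M}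
    = (if r = 1 then BK1 W else BK0 W)" .
  have ex: "\<exists>G\<in>\<G>. laplacian_energy n v G = complex_of_real M"
    using exists_block_chain_digraph[OF assms(4)] chain_in chain tight by blast
  have "Re (laplacian_energy n v G) \<le> M" if "G \<in> \<G>" for G
  proof -
    have "real_of_int (3 * ?e G) \<le> 3 * M"
      unfolding M of_int_le_iff
      using c3_free_rel.energy_le[OF dig(3)[OF that] fin] unfolding card .
    then show ?thesis unfolding le[OF that] by simp
  qed
  moreover have "laplacian_energy n v G \<in> \<real>" if "G \<in> \<G>" for G
    unfolding le[OF that] by simp
  ultimately show ?thesis using ex set by blast
qed

end
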